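(* Suppose the following statement (Conjecture 2) holds: for every Artin-Tits group $A_I$ (associated with a finite simplicial labelled graph with vertex set $I$), every subset $X\subseteq I$ and every $\omega\in CA_I$, the subgroup $(\omega A_X\omega^{-1})\cap A_X$ is a parabolic subgroup of $A_I$. Then the following statement (Conjecture 1) holds: for every Artin-Tits group $A_I$, all subsets $X,Y\subseteq I$ and every $\omega\in A_I$, the subgroup $(\omega A_Y\omega^{-1})\cap A_X$ is a parabolic subgroup of $A_I$.
   Context: Let $\Gamma=(I,E,m)$ be a finite simplicial graph with vertex set $I$, edge set $E$ and edge labelling $m:E\to\mathbb{N}_{\ge 2}$; write $m(i,j)$ for $m(\{i,j\})$. The Artin-Tits group $A_I$ associated with $\Gamma$ is generated by $\Sigma_I=\{\sigma_i\mid i\in I\}$ with relations $\sigma_i\sigma_j\sigma_i\cdots=\sigma_j\sigma_i\sigma_j\cdots$ ($m(i,j)$ terms on each side) for each $\{i,j\}\in E$ (no relation between $\sigma_i$ and $\sigma_j$ if $\{i,j\}\notin E$). The Coxeter group $W_I$ is generated by $S_I=\{s_i\mid i\in I\}$ with relations $s_i^2=1$ for $i\in I$ and $s_is_js_i\cdots=s_js_is_j\cdots$ ($m(i,j)$ terms on each side) for each $\{i,j\}\in E$. Let $\theta_I:A_I\to W_I$ be the group morphism $\sigma_i\mapsto s_i$; its kernel is denoted $CA_I$ (the colored Artin-Tits group). For $X\subseteq I$, $A_X$ denotes the subgroup of $A_I$ generated by $\Sigma_X=\{\sigma_i\mid i\in X\}$ (a standard parabolic subgroup); it is naturally isomorphic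 to the Artin-Tits group of the full labelled subgraph spanned by $X$. A parabolic subgroup of $A_I$ is a subgroup conjugate in $A_I$ to some $A_X$ with $X\subseteq I$. *)

theory Defs
  imports "HOL-Algebra.Generated_Groups"
begin

text \<open>
  The letter \<open>(a, True)\<close> stands for the generator \<open>a\<close> and \<open>(a, False)\<close> for its inverse.
\<close>

type_synonym 'a word = "('a \<times> bool) list"

definition words :: "'a set \<Rightarrow> 'a word set" where
  "words S = lists (S \<times> UNIV)"

text \<open>
  The congruence on words over \<open>S\<close> and its formal inverses that defines the group
  presented by the generators \<open>S\<close> and the relations \<open>u = v\<close> for \<open>(u, v) \<in> R\<close>.
\<close>

inductive_set pres_rel :: "'a set \<Rightarrow> ('a word \<times> 'a word) set \<Rightarrow> ('a word \<times> 'a word) set"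
  for S :: "'a set" and R :: "('a word \<times> 'a word) set"
where
  refl: "w \<in> words S \<Longrightarrow> (w, w) \<in> pres_rel S R"
| sym: "(u, v) \<in> pres_rel S R \<Longrightarrow> (v, u) \<in> pres_rel S R"
| trans: "(u, v) \<in> pres_rel S R \<Longrightarrow> (v, w) \<in> pres_rel S R \<Longrightarrow> (u, w) \<in> pres_rel S R"
| cancel: "a \<in> S \<Longrightarrow> p \<in> words S \<Longrightarrow> q \<in> words S \<Longrightarrow>
    (p @ [(a, e), (a, \<not> e)] @ q, p @ q) \<in> pres_rel S R"
| relator: "(u, v) \<in> R \<Longrightarrow> u \<in> words S \<Longrightarrow> v \<in> words S \<Longrightarrow> p \<in> words S \<Longrightarrow> q \<in> words S \<Longrightarrow>
    (p @ u @ q, p @ v @ q) \<in> pres_rel S R"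

definition presented_group :: "'a set \<Rightarrow> ('a word \<times> 'a word) set \<Rightarrow> 'a word set monoid" where
  "presented_group S R =
    \<lparr>carrier = words S // pres_rel S R,
     monoid.mult = (\<lambda>A B. \<Union>a\<in>A. \<Union>b\<in>B. pres_rel S R `` {a @ b}),
     monoid.one = pres_rel S R `` {[]}\<rparr>"

definition pres_gen :: "'a set \<Rightarrow> ('a word \<times> 'a word) set \<Rightarrow> 'a \<Rightarrow> 'a word set" where
  "pres_gen S R a = pres_rel S R `` {[(a, True)]}"

text \<open>
  The values of \<open>m\<close> outside \<open>E\<close> are irrelevant. Up to isomorphism every finite graph has its
  vertices in \<open>nat\<close>, so a statement about all graphs may be assumed for this type only.
\<close>

definition labelled_graph :: "'v set \<Rightarrow> 'v set set \<Rightarrow> ('v set \<Rightarrow> nat) \<Rightarrow> bool" where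
  "labelled_graph I E m \<longleftrightarrow>
    finite I \<and> (\<forall>e\<in>E. e \<subseteq> I \<and> card e = 2) \<and> (\<forall>e\<in>E. 2 \<le> m e)"

text \<open>The alternating positive word \<open>i j i \<dots>\<close> with \<open>n\<close> letters.\<close>

fun alt_word :: "'v \<Rightarrow> 'v \<Rightarrow> nat \<Rightarrow> 'v word" where
  "alt_word i j 0 = []"
| "alt_word i j (Suc n) = (i, True) # alt_word j i n"

definition braid_relations :: "'v set set \<Rightarrow> ('v set \<Rightarrow> nat) \<Rightarrow> ('v word \<times> 'v word) set" where
  "braid_relations E m =
    {(alt_word i j (m {i, j}), alt_word j i (m {i, j})) | i j. {i, j} \<in> E}"

definition coxeter_relations ::
    "'v set \<Rightarrow> 'v set set \<Rightarrow> ('v set \<Rightarrow> nat) \<Rightarrow> ('v word \<times> 'v word) set" where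
  "coxeter_relations I E m = {([(i, True), (i, True)], []) | i. i \<in> I} \<union> braid_relations E m"

definition artin_group :: "'v set \<Rightarrow> 'v set set \<Rightarrow> ('v set \<Rightarrow> nat) \<Rightarrow> 'v word set monoid" where
  "artin_group I E m = presented_group I (braid_relations E m)"

definition artin_gen :: "'v set \<Rightarrow> 'v set set \<Rightarrow> ('v set \<Rightarrow> nat) \<Rightarrow> 'v \<Rightarrow> 'v word set" where
  "artin_gen I E m i = pres_gen I (braid_relations E m) i"

definition coxeter_group :: "'v set \<Rightarrow> 'v set set \<Rightarrow> ('v set \<Rightarrow> nat) \<Rightarrow> 'v word set monoid" where
  "coxeter_group I E m = presented_group I (coxeter_relations I E m)"

definition coxeter_gen :: "'v set \<Rightarrow> 'v set set \<Rightarrow> ('v set \<Rightarrow> nat) \<Rightarrow> 'v \<Rightarrow> 'v word set" where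
  "coxeter_gen I E m i = pres_gen I (coxeter_relations I E m) i"

text \<open>
  The morphism sends the class of a word to the class of the same word; that this is the
  group morphism mapping each \<open>\<sigma>\<^sub>i\<close> to \<open>s\<^sub>i\<close> is shown in \<open>artin_to_coxeter_hom\<close> and
  \<open>artin_to_coxeter_gen\<close> below.
\<close>

definition artin_to_coxeter ::
    "'v set \<Rightarrow> 'v set set \<Rightarrow> ('v set \<Rightarrow> nat) \<Rightarrow> 'v word set \<Rightarrow> 'v word set" where
  "artin_to_coxeter I E m A = (\<Union>w\<in>A. pres_rel I (coxeter_relations I E m) `` {w})"

definition colored_artin_group ::
    "'v set \<Rightarrow> 'v set set \<Rightarrow> ('v set \<Rightarrow> nat) \<Rightarrow> 'v word set set" where
  "colored_artin_group I E m =
    kernel (artin_group I E m) (coxeter_group I E m) (artin_to_coxeter I E m)"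

definition standard_parabolic ::
    "'v set \<Rightarrow> 'v set set \<Rightarrow> ('v set \<Rightarrow> nat) \<Rightarrow> 'v set \<Rightarrow> 'v word set set" where
  "standard_parabolic I E m X = generate (artin_group I E m) (artin_gen I E m ` X)"

definition conj_subgroup :: "('a, 'b) monoid_scheme \<Rightarrow> 'a \<Rightarrow> 'a set \<Rightarrow> 'a set" where
  "conj_subgroup G g H = (\<lambda>h. g \<otimes>\<^bsub>G\<^esub> h \<otimes>\<^bsub>G\<^esub> inv\<^bsub>G\<^esub> g) ` H"

definition parabolic_subgroup ::
    "'v set \<Rightarrow> 'v set set \<Rightarrow> ('v set \<Rightarrow> nat) \<Rightarrow> 'v word set set \<Rightarrow> bool" where
  "parabolic_subgroup I E m P \<longleftrightarrow>
    (\<exists>g \<in> carrier (artin_group I E m). \<exists>X \<subseteq> I.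
      P = conj_subgroup (artin_group I E m) g (standard_parabolic I E m X))"


lemma words_simps [simp]:
  "[] \<in> words S"
  "u @ v \<in> words S \<longleftrightarrow> u \<in> words S \<and> v \<in> words S"
  "x # u \<in> words S \<longleftrightarrow> fst x \<in> S \<and> u \<in> words S"
  by (auto simp: words_def mem_Times_iff)

lemma pres_rel_words: "(u, v) \<in> pres_rel S R \<Longrightarrow> u \<in> words S \<and> v \<in> words S"
  by (induction rule: pres_rel.induct) auto

lemma equiv_pres_rel: "equiv (words S) (pres_rel S R)"
proof (rule equivI)
  show "pres_rel S R \<subseteq> words S \<times> words S" using pres_rel_words by auto
  show "refl_on (words S) (pres_rel S R)"
    by (auto simp: refl_on_def intro: pres_rel.refl)
  show "Relation.sym (pres_rel S R)" by (rule symI) (rule pres_rel.sym)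
  show "Relation.trans (pres_rel S R)" by (rule transI) (rule pres_rel.trans)
qed

lemma pres_rel_context:
  "(u, v) \<in> pres_rel S R \<Longrightarrow> p \<in> words S \<Longrightarrow> q \<in> words S \<Longrightarrow> (p @ u @ q, p @ v @ q) \<in> pres_rel S R"
proof (induction rule: pres_rel.induct)
  case (refl w) then show ?case by (intro pres_rel.refl) auto
next
  case (sym u v) show ?case by (rule pres_rel.sym) (use sym in blast)
next
  case (trans u v w) show ?case by (rule pres_rel.trans) (use trans in blast)+
next
  case (cancel a p' q' e)
  then show ?case using pres_rel.cancel[of a S "p @ p'" "q' @ q" e R] by simp
next
  case (relator u v p' q')
  then show ?case using pres_rel.relator[of u v R S "p @ p'" "q' @ q"] by simp
qed

lemma pres_rel_append:
  assumes "(u, u') \<in> pres_rel S R" "(v, v') \<in> pres_rel S R"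
  shows "(u @ v, u' @ v') \<in> pres_rel S R"
proof -
  have w: "v \<in> words S" "u' \<in> words S"
    using pres_rel_words[OF assms(1)] pres_rel_words[OF assms(2)] by simp_all
  have "(u @ v, u' @ v) \<in> pres_rel S R"
    using pres_rel_context[OF assms(1), of "[]" v] w by simp
  moreover have "(u' @ v, u' @ v') \<in> pres_rel S R"
    using pres_rel_context[OF assms(2), of u' "[]"] w by simp
  ultimately show ?thesis by (rule pres_rel.trans)
qed

lemma pres_rel_mono:
  assumes "R \<subseteq> R'" shows "pres_rel S R \<subseteq> pres_rel S R'"
proof -
  have "(u, v) \<in> pres_rel S R'" if "(u, v) \<in> pres_rel S R" for u v
    using that
  proof (induction rule: pres_rel.induct)
    case (refl w) then show ?case by (rule pres_rel.refl)
  next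
    case (sym u v) show ?case by (rule pres_rel.sym) (use sym in blast)
  next
    case (trans u v w) show ?case by (rule pres_rel.trans) (use trans in blast)+
  next
    case (cancel a p q e) then show ?case by (intro pres_rel.cancel)
  next
    case (relator u v p q) then show ?case using assms by (intro pres_rel.relator) auto
  qed
  then show ?thesis by auto
qed

lemma carrier_presented_group:
  "carrier (presented_group S R) = words S // pres_rel S R"
  by (simp add: presented_group_def)

lemma one_presented_group:
  "\<one>\<^bsub>presented_group S R\<^esub> = pres_rel S R `` {[]}"
  by (simp add: presented_group_def)

lemma class_UN_eq:
  assumes "u \<in> words S" "pres_rel S R \<subseteq> pres_rel S R'"
  shows "(\<Union>w \<in> pres_rel S R `` {u}. pres_rel S R' `` {w}) = pres_rel S R' `` {u}"
proof
  show "(\<Union>w \<in> pres_rel S R `` {u}. pres_rel S R' `` {w}) \<subseteq> pres_rel S R' `` {u}"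
    using assms(2) by (blast intro: pres_rel.trans)
  show "pres_rel S R' `` {u} \<subseteq> (\<Union>w \<in> pres_rel S R `` {u}. pres_rel S R' `` {w})"
    using pres_rel.refl[OF assms(1), of R] by blast
qed

lemma mult_presented_group:
  assumes "u \<in> words S" "v \<in> words S"
  shows "pres_rel S R `` {u} \<otimes>\<^bsub>presented_group S R\<^esub> pres_rel S R `` {v} = pres_rel S R `` {u @ v}"
proof -
  have sub: "(u @ v, w) \<in> pres_rel S R"
    if "(u, a) \<in> pres_rel S R" "(v, b) \<in> pres_rel S R" "(a @ b, w) \<in> pres_rel S R" for a b w
    using pres_rel.trans[OF pres_rel_append[OF that(1,2)] that(3)] .
  have "(\<Union>a \<in> pres_rel S R `` {u}. \<Union>b \<in> pres_rel S R `` {v}. pres_rel S R `` {a @ b}) =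
    pres_rel S R `` {u @ v}"
  proof
    show "(\<Union>a \<in> pres_rel S R `` {u}. \<Union>b \<in> pres_rel S R `` {v}. pres_rel S R `` {a @ b})
      \<subseteq> pres_rel S R `` {u @ v}"
      using sub by blast
    show "pres_rel S R `` {u @ v}
      \<subseteq> (\<Union>a \<in> pres_rel S R `` {u}. \<Union>b \<in> pres_rel S R `` {v}. pres_rel S R `` {a @ b})"
      using pres_rel.refl[OF assms(1), of R] pres_rel.refl[OF assms(2), of R] by blast
  qed
  then show ?thesis by (simp add: presented_group_def)
qed

lemma pres_rel_inverse:
  "u \<in> words S \<Longrightarrow> (rev (map (\<lambda>(a, e). (a, \<not> e)) u) @ u, []) \<in> pres_rel S R"
proof (induction u)
  case Nil then show ?case by (auto intro: pres_rel.refl)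
next
  case (Cons x u)
  obtain a e where x: "x = (a, e)" by force
  let ?v = "rev (map (\<lambda>(a, e). (a, \<not> e)) u)"
  have v: "?v \<in> words S" using Cons.prems by (auto simp: words_def lists_eq_set)
  have "(?v @ [(a, \<not> e), (a, \<not> \<not> e)] @ u, ?v @ u) \<in> pres_rel S R"
    using Cons.prems v x by (intro pres_rel.cancel) auto
  moreover have "(?v @ u, []) \<in> pres_rel S R" using Cons by simp
  ultimately have "(?v @ [(a, \<not> e), (a, \<not> \<not> e)] @ u, []) \<in> pres_rel S R" by (rule pres_rel.trans)
  then show ?case by (simp add: x)
qed

lemma group_presented_group: "group (presented_group S R)"
proof (rule groupI)
  let ?G = "presented_group S R"
  have cl: "u \<in> words S \<Longrightarrow> pres_rel S R `` {u} \<in> carrier ?G" for u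
    by (simp add: carrier_presented_group quotientI)
  show "x \<otimes>\<^bsub>?G\<^esub> y \<in> carrier ?G" if "x \<in> carrier ?G" "y \<in> carrier ?G" for x y
    using that unfolding carrier_presented_group
    by (elim quotientE) (simp add: mult_presented_group quotientI)
  show "\<one>\<^bsub>?G\<^esub> \<in> carrier ?G" by (simp add: one_presented_group cl)
  show "x \<otimes>\<^bsub>?G\<^esub> y \<otimes>\<^bsub>?G\<^esub> z = x \<otimes>\<^bsub>?G\<^esub> (y \<otimes>\<^bsub>?G\<^esub> z)"
    if "x \<in> carrier ?G" "y \<in> carrier ?G" "z \<in> carrier ?G" for x y z
    using that unfolding carrier_presented_group
    by (elim quotientE) (simp add: mult_presented_group)
  show "\<one>\<^bsub>?G\<^esub> \<otimes>\<^bsub>?G\<^esub> x = x" if "x \<in> carrier ?G" for x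
    using that unfolding carrier_presented_group one_presented_group
    by (elim quotientE) (simp add: mult_presented_group)
  show "\<exists>y\<in>carrier ?G. y \<otimes>\<^bsub>?G\<^esub> x = \<one>\<^bsub>?G\<^esub>" if x: "x \<in> carrier ?G" for x
  proof -
    obtain u where u: "u \<in> words S" "x = pres_rel S R `` {u}"
      using x unfolding carrier_presented_group by (elim quotientE)
    let ?v = "rev (map (\<lambda>(a, e). (a, \<not> e)) u)"
    have v: "?v \<in> words S" using u by (auto simp: words_def lists_eq_set)
    have "pres_rel S R `` {?v @ u} = pres_rel S R `` {[]}"
      by (rule equiv_class_eq[OF equiv_pres_rel pres_rel_inverse[OF u(1)]])
    then have "pres_rel S R `` {?v} \<otimes>\<^bsub>?G\<^esub> x = \<one>\<^bsub>?G\<^esub>"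
      using u v by (simp add: mult_presented_group one_presented_group)
    then show ?thesis using cl[OF v] by blast
  qed
qed

lemma artin_to_coxeter_class:
  assumes "u \<in> words I"
  shows "artin_to_coxeter I E m (pres_rel I (braid_relations E m) `` {u}) =
    pres_rel I (coxeter_relations I E m) `` {u}"
  unfolding artin_to_coxeter_def
  by (rule class_UN_eq[OF assms pres_rel_mono]) (auto simp: coxeter_relations_def)

lemma artin_to_coxeter_hom:
  "artin_to_coxeter I E m \<in> hom (artin_group I E m) (coxeter_group I E m)"
  unfolding artin_group_def coxeter_group_def
proof (rule homI)
  fix x assume "x \<in> carrier (presented_group I (braid_relations E m))"
  then show "artin_to_coxeter I E m x \<in> carrier (presented_group I (coxeter_relations I E m))"
    unfolding carrier_presented_group
    by (elim quotientE) (simp add: artin_to_coxeter_class quotientI)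
next
  fix x y
  assume "x \<in> carrier (presented_group I (braid_relations E m))"
    "y \<in> carrier (presented_group I (braid_relations E m))"
  then show "artin_to_coxeter I E m (x \<otimes>\<^bsub>presented_group I (braid_relations E m)\<^esub> y) =
    artin_to_coxeter I E m x \<otimes>\<^bsub>presented_group I (coxeter_relations I E m)\<^esub> artin_to_coxeter I E m y"
    unfolding carrier_presented_group
    by (elim quotientE) (simp add: artin_to_coxeter_class mult_presented_group)
qed

lemma artin_to_coxeter_gen:
  "i \<in> I \<Longrightarrow> artin_to_coxeter I E m (artin_gen I E m i) = coxeter_gen I E m i"
  by (simp add: artin_gen_def coxeter_gen_def pres_gen_def artin_to_coxeter_class)

end

theory Submission
  imports Defs Complex_Main
begin

text \<open>
Let \<open>P = \<omega> A\<^sub>Y \<omega>\<inverse> \<inter> A\<^sub>X\<close>. The Coxeter group \<open>W\<close> acts on the set \<open>D\<^sub>X\<close> of minimal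
representatives of the cosets \<open>W\<^sub>X w\<close>: a simple reflection \<open>s\<close> sends \<open>w\<close> to \<open>w s\<close> if this is again in
\<open>D\<^sub>X\<close>, and fixes \<open>w\<close> otherwise; in the second case \<open>w s w\<inverse>\<close> is a simple reflection \<open>x \<in> X\<close>.
Emitting \<open>\<sigma>\<^sub>x\<close> (or its inverse, for an inverse letter) at each fixed step and nothing at each moving
step turns a word in the Artin generators into a word over \<open>X\<close>, depending on the starting point.
The emitted word depends, as an element of \<open>A\<^sub>X\<close>, only on the element of the Artin group
(\<open>cocycle_cong\<close>), so the construction is a cocycle with values in \<open>A\<^sub>X\<close>; started at \<open>1\<close> it
restricts to the identity of \<open>A\<^sub>X\<close>.

Multiplying \<open>\<omega>\<close> on the right by an element of \<open>A\<^sub>Y\<close> does not change \<open>P\<close>, and it allows the point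
\<open>d \<in> D\<^sub>X\<close> reached from \<open>1\<close> along \<open>\<omega>\<close> to be taken minimal in \<open>d W\<^sub>Y\<close>. Let \<open>p \<in> A\<^sub>X\<close> be emitted on
the way. If \<open>a \<omega> = \<omega> b\<close> with \<open>a \<in> A\<^sub>X\<close> and \<open>b \<in> A\<^sub>Y\<close>, then comparing the emitted elements gives
\<open>a p = p z\<close>, where \<open>z\<close> is emitted along \<open>b\<close> from \<open>d\<close>. By minimality of \<open>d\<close> only generators
\<open>x \<in> X\<close> whose root is \<open>d(\<alpha>\<^sub>y)\<close> for some \<open>y \<in> Y\<close> are emitted there; let \<open>Z\<close> be the set of these
\<open>x\<close>. Hence \<open>P\<close> lies in \<open>p A\<^sub>Z p\<inverse>\<close>, and after conjugation by \<open>p\<close> it becomes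
\<open>v A\<^sub>Y v\<inverse> \<inter> A\<^sub>Z\<close>, where \<open>v = p\<inverse> \<omega>\<close> maps to \<open>d\<close> in \<open>W\<close>
(\<open>intersection_in_matched_parabolic\<close>).

The same argument applied to \<open>v\<inverse>\<close>, with \<open>Y\<close> and \<open>Z\<close> in the roles of \<open>X\<close> and \<open>Y\<close>, replaces \<open>Y\<close> by
the set \<open>Y'\<close> of those \<open>y\<close> with \<open>d(\<alpha>\<^sub>y) = \<alpha>\<^sub>z\<close> for some \<open>z \<in> Z\<close>. Up to conjugation \<open>P\<close> is now
\<open>w A\<^sub>Z w\<inverse> \<inter> A\<^bsub>Y'\<^esub>\<close> for some \<open>w\<close> lying over \<open>d\<inverse>\<close>, and \<open>d\<inverse>\<close> maps the simple roots of \<open>Z\<close>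
onto those of \<open>Y'\<close>. By Matsumoto's theorem the positive lift \<open>r\<close> of a reduced expression of \<open>d\<inverse>\<close>
satisfies \<open>r A\<^sub>Z r\<inverse> = A\<^bsub>Y'\<^esub>\<close> (\<open>conj_lift_parab\<close>). Therefore \<open>k = r\<inverse> w\<close> is colored, and \<open>P\<close> is
conjugate to \<open>k A\<^sub>Z k\<inverse> \<inter> A\<^sub>Z\<close>, which is parabolic by assumption.

The facts about \<open>W\<close> are obtained from its reflection representation on root coordinates: every root
is nonnegative or nonpositive, which describes descents. This shows that all reduced words of an
element agree in the Artin group (\<open>matsumoto\<close>) and that the representation is faithful. The
assumption speaks of graphs on natural numbers only; the last step carries the colored case over
to an arbitrary finite graph along an injective numbering of its vertices.
\<close>

section \<open>Chebyshev recursion at the angles of a dihedral group\<close>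

text \<open>
Chebyshev polynomials of the second kind, shifted by one: for \<open>c = 2 cos t\<close> the value is
\<open>sin (n t) / sin t\<close>. They are the coordinates of the roots of a rank two reflection group.
\<close>

fun cheb :: "real \<Rightarrow> nat \<Rightarrow> real" where
  "cheb c 0 = 0"
| "cheb c (Suc 0) = 1"
| "cheb c (Suc (Suc n)) = c * cheb c (Suc n) - cheb c n"

lemma cheb_cos: "sin t * cheb (2 * cos t) n = sin (real n * t)"
proof (induction "2 * cos t" n rule: cheb.induct)
  case (3 n)
  have "sin (real (Suc (Suc n)) * t) + sin (real n * t) = 2 * cos t * sin (real (Suc n) * t)"
    using sin_add[of "real (Suc n) * t" t] sin_diff[of "real (Suc n) * t" t]
    by (simp add: algebra_simps)
  then show ?case using 3 by (simp add: algebra_simps)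
qed auto

lemma cheb_two: "cheb 2 n = real n"
  by (induction "2::real" n rule: cheb.induct) auto

context
  fixes n :: nat
  assumes n: "2 \<le> n"
begin

lemma sin_pi_over_pos: "0 < sin (pi / real n)"
  using n by (intro sin_gt_zero) (auto simp: field_simps)

lemma cheb_cos_pos:
  assumes "0 < k" "k < n"
  shows "0 < cheb (2 * cos (pi / real n)) k"
proof -
  have "0 < sin (real k * (pi / real n))"
    using assms n by (intro sin_gt_zero) (auto simp: field_simps)
  then show ?thesis
    using cheb_cos[of "pi / real n" k] sin_pi_over_pos by (metis zero_less_mult_pos)
qed

lemma cheb_cos_period:
  "cheb (2 * cos (pi / real n)) n = 0"
  "cheb (2 * cos (pi / real n)) (n - 1) = 1"
  "cheb (2 * cos (pi / real n)) (Suc n) = - 1"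
proof -
  let ?t = "pi / real n"
  have nz: "sin ?t \<noteq> 0" using sin_pi_over_pos by simp
  have "sin ?t * cheb (2 * cos ?t) n = 0"
    using cheb_cos[of ?t n] n by simp
  then show 0: "cheb (2 * cos ?t) n = 0" using nz by simp
  have "real (n - 1) * ?t = pi - ?t" using n by (simp add: field_simps of_nat_diff)
  then have "sin ?t * cheb (2 * cos ?t) (n - 1) = sin ?t"
    using cheb_cos[of ?t "n - 1"] by simp
  then show 1: "cheb (2 * cos ?t) (n - 1) = 1" using nz by simp
  obtain k where k: "n = Suc k" using n by (cases n) auto
  show "cheb (2 * cos ?t) (Suc n) = - 1"
    using 0 1 unfolding k by simp
qed

lemma cos_pi_over_less_one: "cos (pi / real n) < 1"
  using n cos_monotone_0_pi[of 0 "pi / real n"] by (auto simp: field_simps)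

end

section \<open>The reflection representation of the Coxeter group\<close>

locale artin_graph =
  fixes I :: "'v set" and E :: "'v set set" and m :: "'v set \<Rightarrow> nat"
  assumes labelled_graph: "labelled_graph I E m"
begin

lemma finite_I: "finite I"
  using labelled_graph by (simp add: labelled_graph_def)

lemma edgeD:
  assumes "{i, j} \<in> E"
  shows "i \<in> I" "j \<in> I" "i \<noteq> j" "2 \<le> m {i, j}"
proof -
  have *: "{i, j} \<subseteq> I \<and> card {i, j} = 2 \<and> 2 \<le> m {i, j}"
    using assms labelled_graph by (auto simp: labelled_graph_def)
  then show "i \<in> I" "j \<in> I" "2 \<le> m {i, j}" by auto
  show "i \<noteq> j" using * by auto
qed

text \<open>
A missing edge stands for the label \<open>\<infinity>\<close>, for which \<open>- 2 cos (\<pi> / m)\<close> becomes \<open>- 2\<close>.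
\<close>

definition cartan :: "'v \<Rightarrow> 'v \<Rightarrow> real" where
  "cartan i j = (if i = j then 2
    else if {i, j} \<in> E then - 2 * cos (pi / real (m {i, j})) else - 2)"

lemma cartan_commute: "cartan i j = cartan j i"
  by (simp add: cartan_def insert_commute)

definition bil :: "('v \<Rightarrow> real) \<Rightarrow> ('v \<Rightarrow> real) \<Rightarrow> real" where
  "bil f g = (\<Sum>k\<in>I. \<Sum>l\<in>I. f k * g l * cartan k l)"

definition simple_root :: "'v \<Rightarrow> 'v \<Rightarrow> real" ("\<alpha>") where
  "\<alpha> i = (\<lambda>k. if k = i then 1 else 0)"

lemma simple_root_eq_iff: "\<alpha> i = \<alpha> j \<longleftrightarrow> i = j"
  by (auto simp: simple_root_def fun_eq_iff split: if_splits)

lemma bil_commute: "bil f g = bil g f"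
  unfolding bil_def by (subst sum.swap) (simp add: cartan_commute mult.commute)

lemma bil_lin: "bil (\<lambda>k. a * f k + b * g k) h = a * bil f h + b * bil g h"
  unfolding bil_def by (simp add: algebra_simps sum.distrib sum_distrib_left)

lemma bil_lin_right: "bil h (\<lambda>k. a * f k + b * g k) = a * bil h f + b * bil h g"
  using bil_lin[of a f b g h] by (simp only: bil_commute[of h])

lemma bil_simple_root:
  assumes "i \<in> I" shows "bil f (\<alpha> i) = (\<Sum>k\<in>I. f k * cartan k i)"
proof -
  have "(\<Sum>l\<in>I. f k * \<alpha> i l * cartan k l) = (\<Sum>l\<in>I. if l = i then f k * cartan k i else 0)" for k
    by (rule sum.cong) (auto simp: simple_root_def)
  then have "(\<Sum>l\<in>I. f k * \<alpha> i l * cartan k l) = f k * cartan k i" for k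
    using assms finite_I by simp
  then show ?thesis by (simp add: bil_def)
qed

lemma bil_simple_roots:
  assumes "i \<in> I" "j \<in> I" shows "bil (\<alpha> i) (\<alpha> j) = cartan i j"
proof -
  have "(\<Sum>k\<in>I. \<alpha> i k * cartan k j) = (\<Sum>k\<in>I. if k = i then cartan i j else 0)"
    by (rule sum.cong) (auto simp: simple_root_def)
  then show ?thesis using assms finite_I by (simp add: bil_simple_root)
qed

text \<open>
The vectors of the reflection representation are all real functions on the vertex type, so that
group elements are plain functions under composition; values of a vector outside \<open>I\<close> are
neither read nor changed.
\<close>

definition reflection :: "'v \<Rightarrow> ('v \<Rightarrow> real) \<Rightarrow> 'v \<Rightarrow> real" where
  "reflection i f = (\<lambda>k. f k - bil f (\<alpha> i) * \<alpha> i k)"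

lemma reflection_lin:
  "reflection i (\<lambda>k. a * f k + b * g k) = (\<lambda>k. a * reflection i f k + b * reflection i g k)"
  by (auto simp: reflection_def bil_lin algebra_simps)

lemma bil_reflection:
  assumes "i \<in> I" shows "bil (reflection i f) (reflection i g) = bil f g"
proof -
  define a b where "a = bil f (\<alpha> i)" and "b = bil g (\<alpha> i)"
  have f: "reflection i f = (\<lambda>k. 1 * f k + (- a) * \<alpha> i k)"
    and g: "reflection i g = (\<lambda>k. 1 * g k + (- b) * \<alpha> i k)"
    by (auto simp: reflection_def a_def b_def)
  have "bil (reflection i f) (reflection i g) = bil f g - b * a - a * (b - b * 2)"
    unfolding f g bil_lin bil_lin_right
    using assms by (simp add: bil_simple_roots cartan_def a_def b_def bil_commute[of "\<alpha> i" g])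
  then show ?thesis by (simp add: algebra_simps)
qed

lemma reflection_simple_root:
  assumes "i \<in> I" "j \<in> I"
  shows "reflection i (\<alpha> j) = (\<lambda>k. \<alpha> j k - cartan j i * \<alpha> i k)"
  using assms by (simp add: reflection_def bil_simple_roots)

lemma reflection_simple_root_self:
  assumes "i \<in> I" shows "reflection i (\<alpha> i) = (\<lambda>k. - \<alpha> i k)"
  using assms by (auto simp: reflection_simple_root cartan_def)

lemma reflection_reflection:
  assumes "i \<in> I" shows "reflection i (reflection i f) = f"
proof -
  have "reflection i f = (\<lambda>k. 1 * f k + (- bil f (\<alpha> i)) * \<alpha> i k)"
    by (simp add: reflection_def)
  then have "reflection i (reflection i f) =
    (\<lambda>k. 1 * reflection i f k + (- bil f (\<alpha> i)) * reflection i (\<alpha> i) k)"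
    using reflection_lin by presburger
  also have "\<dots> = f"
    using assms by (auto simp: reflection_simple_root_self) (simp add: reflection_def)
  finally show ?thesis .
qed

lemma reflection_o_reflection [simp]:
  assumes "i \<in> I" shows "reflection i \<circ> reflection i = id"
  by (auto simp: reflection_reflection[OF assms])

lemma reflection_cancel [simp]:
  assumes "i \<in> I" shows "w \<circ> reflection i \<circ> reflection i = w"
  by (metis assms comp_assoc comp_id reflection_o_reflection)

primrec act :: "'v list \<Rightarrow> ('v \<Rightarrow> real) \<Rightarrow> 'v \<Rightarrow> real" where
  "act [] = id"
| "act (i # u) = reflection i \<circ> act u"

lemma act_append: "act (u @ v) = act u \<circ> act v"
  by (induction u) auto

lemma act_snoc: "act (u @ [i]) = act u \<circ> reflection i"
  by (simp add: act_append)

lemma act_lin: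
  "act u (\<lambda>k. a * f k + b * g k) = (\<lambda>k. a * act u f k + b * act u g k)"
  by (induction u) (auto simp: reflection_lin)

lemma bil_act: "u \<in> lists I \<Longrightarrow> bil (act u f) (act u g) = bil f g"
  by (induction u) (auto simp: bil_reflection)

lemma act_rev:
  assumes "u \<in> lists I"
  shows "act u (act (rev u) f) = f" "act (rev u) (act u f) = f"
  using assms
  by (induction u arbitrary: f) (auto simp: act_append reflection_reflection)

definition cox_group :: "(('v \<Rightarrow> real) \<Rightarrow> 'v \<Rightarrow> real) set" where
  "cox_group = act ` lists I"

lemma coxE:
  assumes "w \<in> cox_group" obtains u where "u \<in> lists I" "w = act u"
  using assms by (auto simp: cox_group_def)

lemma act_in_cox [simp]: "u \<in> lists I \<Longrightarrow> act u \<in> cox_group"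
  by (auto simp: cox_group_def)

lemma id_in_cox [simp]: "id \<in> cox_group"
  using act_in_cox[of "[]"] by simp

lemma cox_comp_act [simp]:
  assumes "w \<in> cox_group" "u \<in> lists I" shows "w \<circ> act u \<in> cox_group"
proof -
  obtain v where "v \<in> lists I" "w = act v" using assms(1) by (rule coxE)
  then show ?thesis using act_in_cox[of "v @ u"] assms(2) by (simp add: act_append)
qed

lemma cox_comp_reflection [simp]:
  assumes "w \<in> cox_group" "i \<in> I" shows "w \<circ> reflection i \<in> cox_group"
  using cox_comp_act[OF assms(1), of "[i]"] assms(2) by simp

lemma cox_lin:
  assumes "w \<in> cox_group"
  shows "w (\<lambda>k. a * f k + b * g k) = (\<lambda>k. a * w f k + b * w g k)"
  using assms by (rule coxE) (simp add: act_lin)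

lemma cox_minus:
  assumes "w \<in> cox_group" shows "w (\<lambda>k. - f k) = (\<lambda>k. - w f k)"
  using cox_lin[OF assms, of "-1" f 0 f] by simp

lemma bil_cox: "w \<in> cox_group \<Longrightarrow> bil (w f) (w g) = bil f g"
  by (erule coxE) (simp add: bil_act)

lemma cox_eqD:
  assumes "w \<in> cox_group" "w f = w g" shows "f = g"
proof -
  obtain u where "u \<in> lists I" "w = act u" using assms(1) by (rule coxE)
  then show ?thesis using act_rev(2)[of u] assms(2) by metis
qed

lemma cox_sum:
  assumes "w \<in> cox_group" "finite Y"
  shows "w (\<lambda>k. \<Sum>y\<in>Y. a y * f y k) = (\<lambda>k. \<Sum>y\<in>Y. a y * w (f y) k)"
  using assms(2)
proof (induction Y rule: finite_induct)
  case empty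
  then show ?case using cox_lin[OF assms(1), of 0 "\<lambda>_. 0" 0 "\<lambda>_. 0"] by simp
next
  case (insert y Y)
  then show ?case
    using cox_lin[OF assms(1), of "a y" "f y" 1 "\<lambda>k. \<Sum>y\<in>Y. a y * f y k"] by simp
qed

text \<open>
The form is invariant, so an element carrying one simple root to another intertwines the two
reflections, which are determined by the roots.
\<close>

lemma cox_reflection_conj:
  assumes "w \<in> cox_group" "s \<in> I" "t \<in> I" "w (\<alpha> s) = \<alpha> t"
  shows "w \<circ> reflection s = reflection t \<circ> w"
proof
  fix f
  have "w (reflection s f) = w (\<lambda>k. 1 * f k + (- bil f (\<alpha> s)) * \<alpha> s k)"
    by (simp add: reflection_def)
  also have "\<dots> = (\<lambda>k. w f k - bil f (\<alpha> s) * \<alpha> t k)"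
    by (simp only: cox_lin[OF assms(1)] assms(4)) simp
  also have "bil f (\<alpha> s) = bil (w f) (\<alpha> t)"
    using bil_cox[OF assms(1), of f "\<alpha> s"] assms(4) by simp
  finally show "(w \<circ> reflection s) f = (reflection t \<circ> w) f"
    by (simp add: reflection_def)
qed

definition nonneg :: "('v \<Rightarrow> real) \<Rightarrow> bool" where
  "nonneg f \<longleftrightarrow> (\<forall>k. 0 \<le> f k)"

lemma nonneg_simple_root [simp]: "nonneg (\<alpha> i)"
  by (simp add: nonneg_def simple_root_def)

lemma not_nonneg_minus_simple_root [simp]: "\<not> nonneg (\<lambda>k. - \<alpha> i k)"
  by (auto simp: nonneg_def simple_root_def)

lemma nonneg_lin: "nonneg f \<Longrightarrow> nonneg g \<Longrightarrow> 0 \<le> a \<Longrightarrow> 0 \<le> b \<Longrightarrow> nonneg (\<lambda>k. a * f k + b * g k)"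
  by (simp add: nonneg_def)

lemma nonneg_antisym: "nonneg f \<Longrightarrow> nonneg (\<lambda>k. - f k) \<Longrightarrow> f = (\<lambda>k. 0)"
  by (auto simp: nonneg_def intro!: ext antisym)

lemma root_nonzero:
  assumes "w \<in> cox_group" "s \<in> I" shows "w (\<alpha> s) \<noteq> (\<lambda>k. 0)"
proof
  assume "w (\<alpha> s) = (\<lambda>k. 0)"
  then have "w (\<alpha> s) = w (\<lambda>k. 0)"
    using cox_lin[OF assms(1), of 0 "\<alpha> s" 0 "\<alpha> s"] by simp
  then have "\<alpha> s = (\<lambda>k. 0)" by (rule cox_eqD[OF assms(1)])
  then show False by (auto simp: simple_root_def fun_eq_iff split: if_splits)
qed

text \<open>
Roots have a fixed length for the invariant form, so a nonnegative root on the line of a simple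
root equals it.
\<close>

lemma nonneg_root_multiple_simple:
  assumes "w \<in> cox_group" "y \<in> I" "x \<in> I" "nonneg (w (\<alpha> y))"
    and "\<And>k. k \<noteq> x \<Longrightarrow> w (\<alpha> y) k = 0"
  shows "w (\<alpha> y) = \<alpha> x"
proof -
  define a where "a = w (\<alpha> y) x"
  have eq: "w (\<alpha> y) = (\<lambda>k. a * \<alpha> x k + 0 * \<alpha> x k)"
    using assms(5) by (auto simp: a_def simple_root_def fun_eq_iff)
  have "2 = bil (w (\<alpha> y)) (w (\<alpha> y))"
    using bil_cox[OF assms(1), of "\<alpha> y" "\<alpha> y"] assms(2) by (simp add: bil_simple_roots cartan_def)
  also have "\<dots> = a * (a * 2)"
    unfolding eq bil_lin bil_lin_right using assms(3) by (simp add: bil_simple_roots cartan_def)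
  finally have "a\<^sup>2 = 1" by (simp add: power2_eq_square)
  moreover have "0 \<le> a" using assms(4) by (simp add: nonneg_def a_def)
  ultimately have "a = 1" by (simp add: power2_eq_1_iff)
  then show ?thesis using eq by simp
qed

end

section \<open>Alternating words\<close>

definition alt_letter :: "'v \<Rightarrow> 'v \<Rightarrow> nat \<Rightarrow> 'v" where
  "alt_letter s t n = (if even n then t else s)"

text \<open>
Alternating words are indexed from their right end: \<open>alt_end s t n\<close> ends in \<open>t\<close> for every
positive \<open>n\<close>, and \<open>alt_letter s t k\<close> is its letter with \<open>k\<close> letters to the right. This is the shape
that appears when descents are stripped off a group element from the right.
\<close>

primrec alt_end :: "'v \<Rightarrow> 'v \<Rightarrow> nat \<Rightarrow> 'v list" where
  "alt_end s t 0 = []"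
| "alt_end s t (Suc n) = alt_letter s t n # alt_end s t n"

lemma alt_letter_in: "s \<in> S \<Longrightarrow> t \<in> S \<Longrightarrow> alt_letter s t n \<in> S"
  by (simp add: alt_letter_def)

lemma alt_letter_Suc_Suc [simp]: "alt_letter s t (Suc (Suc n)) = alt_letter s t n"
  by (simp add: alt_letter_def)

lemma alt_letter_swap: "alt_letter t s n = alt_letter s t (Suc n)"
  by (simp add: alt_letter_def)

lemma length_alt_end [simp]: "length (alt_end s t n) = n"
  by (induction n) auto

lemma alt_end_in_lists: "s \<in> S \<Longrightarrow> t \<in> S \<Longrightarrow> alt_end s t n \<in> lists S"
  by (induction n) (auto simp: alt_letter_in)

lemma alt_end_snoc: "alt_end s t (Suc n) = alt_end t s n @ [t]"
  by (induction n) (auto simp: alt_letter_def)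

definition positive :: "'v list \<Rightarrow> 'v word" where
  "positive u = map (\<lambda>i. (i, True)) u"

lemma positive_simps [simp]:
  "positive [] = []"
  "positive (i # u) = (i, True) # positive u"
  "positive (u @ v) = positive u @ positive v"
  "map fst (positive u) = u"
  by (auto simp: positive_def comp_def)

lemma positive_in_words: "positive u \<in> words S \<longleftrightarrow> u \<in> lists S"
  by (induction u) auto

lemma map_fst_in_lists: "u \<in> words S \<Longrightarrow> map fst u \<in> lists S"
  by (induction u) auto

lemma alt_word_eq_alt_end:
  "alt_word i j n = positive (if even n then alt_end i j n else alt_end j i n)"
  by (induction n arbitrary: i j) (auto simp: alt_letter_def)

context artin_graph
begin

lemma cartan_self [simp]: "cartan i i = 2"
  by (simp add: cartan_def)

lemma cartan_alt_letter:
  assumes "s \<noteq> t"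
  shows "cartan (alt_letter s t (Suc n)) (alt_letter s t n) = cartan s t"
  by (auto simp: alt_letter_def cartan_commute)

text \<open>
Each further reflection replaces two consecutive Chebyshev coefficients by the next two.
\<close>

lemma act_alt_end_root:
  assumes "s \<in> I" "t \<in> I" "s \<noteq> t"
  shows "act (alt_end s t n) (\<alpha> s) = (\<lambda>k. cheb (- cartan s t) (Suc n) * \<alpha> (alt_letter s t (Suc n)) k
    + cheb (- cartan s t) n * \<alpha> (alt_letter s t n) k)"
proof (induction n)
  case 0
  then show ?case by (simp add: alt_letter_def)
next
  case (Suc n)
  let ?a = "alt_letter s t n" and ?b = "alt_letter s t (Suc n)" and ?U = "cheb (- cartan s t)"
  have I: "?a \<in> I" "?b \<in> I" using assms by (auto simp: alt_letter_in)
  have "act (alt_end s t (Suc n)) (\<alpha> s) =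
    reflection ?a (\<lambda>k. ?U (Suc n) * \<alpha> ?b k + ?U n * \<alpha> ?a k)"
    using Suc by simp
  also have "\<dots> = (\<lambda>k. ?U (Suc n) * (\<alpha> ?b k - cartan s t * \<alpha> ?a k) - ?U n * \<alpha> ?a k)"
    unfolding reflection_lin
    using I assms(3) by (simp add: reflection_simple_root reflection_simple_root_self cartan_alt_letter)
  finally show ?case by (simp add: algebra_simps)
qed

lemma cheb_edge:
  assumes "{s, t} \<in> E"
  shows "\<And>k. 0 < k \<Longrightarrow> k < m {s, t} \<Longrightarrow> 0 < cheb (- cartan s t) k"
    and "cheb (- cartan s t) (m {s, t}) = 0"
    and "cheb (- cartan s t) (m {s, t} - 1) = 1"
    and "cheb (- cartan s t) (Suc (m {s, t})) = -1"
  using edgeD[OF assms] assms cheb_cos_pos cheb_cos_period by (auto simp: cartan_def)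

lemma cheb_non_edge:
  assumes "s \<noteq> t" "{s, t} \<notin> E" shows "cheb (- cartan s t) k = real k"
  using assms by (simp add: cartan_def cheb_two)

lemma cheb_nonneg:
  assumes "s \<noteq> t" "{s, t} \<in> E \<Longrightarrow> k \<le> m {s, t}" shows "0 \<le> cheb (- cartan s t) k"
proof (cases "{s, t} \<in> E")
  case True
  then show ?thesis
    using cheb_edge(1)[OF True, of k] cheb_edge(2)[OF True] assms(2)
    by (cases "k = 0"; cases "k = m {s, t}") force+
qed (use assms cheb_non_edge in auto)

lemma act_braid_root:
  assumes "{s, t} \<in> E"
  shows "act (alt_end s t (m {s, t})) (\<alpha> s) = (\<lambda>k. - \<alpha> (alt_letter s t (Suc (m {s, t}))) k)"
    and "act (alt_end s t (m {s, t})) (\<alpha> t) = (\<lambda>k. - \<alpha> (alt_letter s t (m {s, t})) k)"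
proof -
  note e = edgeD[OF assms]
  show "act (alt_end s t (m {s, t})) (\<alpha> s) = (\<lambda>k. - \<alpha> (alt_letter s t (Suc (m {s, t}))) k)"
    using act_alt_end_root[OF e(1,2,3)] cheb_edge[OF assms] by simp
  obtain n where n: "m {s, t} = Suc n" using e(4) by (cases "m {s, t}") auto
  have u: "alt_end t s n \<in> lists I" using e by (simp add: alt_end_in_lists)
  have "act (alt_end s t (Suc n)) (\<alpha> t) = act (alt_end t s n) (\<lambda>k. - \<alpha> t k)"
    using e by (simp only: alt_end_snoc act_snoc comp_apply reflection_simple_root_self)
  also have "\<dots> = (\<lambda>k. - act (alt_end t s n) (\<alpha> t) k)"
    using u by (intro cox_minus) auto
  also have "act (alt_end t s n) (\<alpha> t) = \<alpha> (alt_letter t s n)"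
    using act_alt_end_root[OF e(2,1), of n] cheb_edge(2,3)[OF assms] e(3) n
    by (simp add: cartan_commute[of t s])
  finally show "act (alt_end s t (m {s, t})) (\<alpha> t) = (\<lambda>k. - \<alpha> (alt_letter s t (m {s, t})) k)"
    using n by (simp add: alt_letter_swap[of t s])
qed

lemma act_fix_orthogonal:
  assumes "bil g (\<alpha> s) = 0" "bil g (\<alpha> t) = 0"
  shows "u \<in> lists {s, t} \<Longrightarrow> act u g = g"
  by (induction u) (auto simp: reflection_def assms)

text \<open>
Two simple roots joined by an edge span a plane on which the form is nondegenerate, because
\<open>(2 cos (\<pi> / m))\<^sup>2 < 4\<close>. Every vector is therefore the sum of a vector fixed by both reflections
and a combination of the two roots, and on the two roots both alternating words are known.
\<close>

lemma act_braid:
  assumes "{s, t} \<in> E"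
  shows "act (alt_end s t (m {s, t})) = act (alt_end t s (m {s, t}))"
proof
  fix f
  note e = edgeD[OF assms]
  let ?A = "act (alt_end s t (m {s, t}))" and ?B = "act (alt_end t s (m {s, t}))"
  define c where "c = - cartan s t"
  have "c\<^sup>2 < 4"
  proof -
    have "c = 2 * cos (pi / real (m {s, t}))" using assms e by (simp add: c_def cartan_def)
    then have "c\<^sup>2 = 4 - 4 * (sin (pi / real (m {s, t})))\<^sup>2"
      by (simp add: power_mult_distrib sin_squared_eq)
    then show ?thesis using sin_pi_over_pos[OF e(4)] by simp
  qed
  then have d: "4 - c\<^sup>2 \<noteq> 0" by simp
  define x y where "x = bil f (\<alpha> s)" and "y = bil f (\<alpha> t)"
  \<comment> \<open>The coefficients of the orthogonal projection onto the plane of the two roots, solving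
    \<open>2 p - c q = x\<close> and \<open>2 q - c p = y\<close>.\<close>
  define p q where "p = (2 * x + c * y) / (4 - c\<^sup>2)" and "q = (c * x + 2 * y) / (4 - c\<^sup>2)"
  have "(4 - c\<^sup>2) * p = 2 * x + c * y" "(4 - c\<^sup>2) * q = c * x + 2 * y"
    using d by (simp_all add: p_def q_def)
  then have "(4 - c\<^sup>2) * (2 * p - c * q) = (4 - c\<^sup>2) * x" "(4 - c\<^sup>2) * (2 * q - c * p) = (4 - c\<^sup>2) * y"
    by algebra+
  then have pq: "x = 2 * p - c * q" "y = 2 * q - c * p"
    using d by simp_all
  define g where "g = (\<lambda>k. 1 * f k + (-1) * (p * \<alpha> s k + q * \<alpha> t k))"
  have "cartan t s = - c" "cartan s t = - c" "cartan s s = 2" "cartan t t = 2"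
    using cartan_commute[of t s] by (auto simp: c_def cartan_def)
  then have "bil g (\<alpha> s) = 0" "bil g (\<alpha> t) = 0"
    unfolding g_def bil_lin using e pq
    by (simp_all add: bil_simple_roots x_def[symmetric] y_def[symmetric])
  then have fix_g: "act u g = g" if "u \<in> lists {s, t}" for u
    using that by (rule act_fix_orthogonal)
  have f: "f = (\<lambda>k. 1 * g k + 1 * (p * \<alpha> s k + q * \<alpha> t k))" by (simp add: g_def)
  have A: "?A f = (\<lambda>k. 1 * ?A g k + 1 * (p * ?A (\<alpha> s) k + q * ?A (\<alpha> t) k))"
    by (subst f) (simp only: act_lin)
  have B: "?B f = (\<lambda>k. 1 * ?B g k + 1 * (p * ?B (\<alpha> s) k + q * ?B (\<alpha> t) k))"
    by (subst f) (simp only: act_lin)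
  have "{t, s} \<in> E" "m {t, s} = m {s, t}" using assms by (simp_all add: insert_commute)
  then have "?B (\<alpha> s) = ?A (\<alpha> s)" "?B (\<alpha> t) = ?A (\<alpha> t)"
    using act_braid_root[OF assms] act_braid_root[of t s] by (simp_all add: alt_letter_swap[of t s])
  moreover have "?A g = g" "?B g = g" by (intro fix_g alt_end_in_lists; simp)+
  ultimately show "?A f = ?B f" unfolding A B by simp
qed

section \<open>Length and the sign of roots\<close>

definition len :: "(('v \<Rightarrow> real) \<Rightarrow> 'v \<Rightarrow> real) \<Rightarrow> nat" where
  "len w = (LEAST n. \<exists>u\<in>lists I. length u = n \<and> act u = w)"

lemma len_act_le: "u \<in> lists I \<Longrightarrow> len (act u) \<le> length u"
  unfolding len_def by (rule Least_le) auto

lemma len_witness: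
  assumes "w \<in> cox_group" obtains u where "u \<in> lists I" "act u = w" "length u = len w"
proof -
  obtain v where "v \<in> lists I" "w = act v" using assms by (rule coxE)
  then have "\<exists>n. \<exists>u\<in>lists I. length u = n \<and> act u = w" by auto
  then have "\<exists>u\<in>lists I. length u = len w \<and> act u = w"
    unfolding len_def by (rule LeastI_ex)
  then show thesis using that by blast
qed

lemma len_id [simp]: "len id = 0"
  using len_act_le[of "[]"] by simp

lemma len_zero_iff:
  assumes "w \<in> cox_group" shows "len w = 0 \<longleftrightarrow> w = id"
proof
  assume "len w = 0"
  then show "w = id" using len_witness[OF assms] by fastforce
qed simp

lemma len_comp_act:
  assumes "w \<in> cox_group" "u \<in> lists I" shows "len (w \<circ> act u) \<le> len w + length u"
proof -
  obtain v where v: "v \<in> lists I" "act v = w" "length v = len w"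
    using assms(1) by (rule len_witness)
  have "len (act (v @ u)) \<le> length (v @ u)" using v assms by (intro len_act_le) auto
  then show ?thesis using v by (simp add: act_append)
qed

lemma len_comp_reflection:
  assumes "w \<in> cox_group" "s \<in> I"
  shows "len (w \<circ> reflection s) \<le> Suc (len w)" "len w \<le> Suc (len (w \<circ> reflection s))"
  using len_comp_act[of w "[s]"] len_comp_act[of "w \<circ> reflection s" "[s]"] assms by simp_all

text \<open>
A length-additive factorisation stays length-additive when letters are moved from the
alternating factor to the left factor.
\<close>

lemma dihedral_truncate:
  assumes "s \<in> I" "t \<in> I" "w \<in> cox_group" "n \<le> k"
    and "v \<in> cox_group" "w = v \<circ> act (alt_end s t k)" "len w = len v + k"
  shows "\<exists>v'\<in>cox_group. w = v' \<circ> act (alt_end s t n) \<and> len w = len v' + n"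
  using assms(4-)
proof (induction k arbitrary: v)
  case 0
  then show ?case by auto
next
  case (Suc k)
  show ?case
  proof (cases "n = Suc k")
    case True
    then show ?thesis using Suc.prems by auto
  next
    case False
    let ?a = "alt_letter s t k"
    have a: "?a \<in> I" using assms by (simp add: alt_letter_in)
    have u: "alt_end s t k \<in> lists I" using assms by (simp add: alt_end_in_lists)
    have w: "w = (v \<circ> reflection ?a) \<circ> act (alt_end s t k)"
      using Suc.prems(3) by (simp add: comp_def)
    have v': "v \<circ> reflection ?a \<in> cox_group" using Suc.prems a by simp
    have "len w \<le> len (v \<circ> reflection ?a) + k"
      using len_comp_act[OF v' u] w by simp
    then have "len w = len (v \<circ> reflection ?a) + k"
      using len_comp_reflection(1)[OF Suc.prems(2) a] Suc.prems(4) by simp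
    moreover have "n \<le> k" using False Suc.prems(1) by simp
    ultimately show ?thesis using Suc.IH v' w by blast
  qed
qed

text \<open>
An alternating suffix of maximal length leaves a factor \<open>v\<close> which neither of the two reflections
shortens: the one that would prolong the suffix by maximality, the other one because
otherwise the whole element would have a shorter expression.
\<close>

lemma dihedral_descent:
  assumes "w \<in> cox_group" "s \<in> I" "t \<in> I" "len (w \<circ> reflection t) < len w"
  obtains v k where "v \<in> cox_group" "0 < k" "w = v \<circ> act (alt_end s t k)" "len w = len v + k"
    "len v \<le> len (v \<circ> reflection s)" "len v \<le> len (v \<circ> reflection t)"
proof -
  define P where "P k \<longleftrightarrow> (\<exists>v\<in>cox_group. w = v \<circ> act (alt_end s t k) \<and> len w = len v + k)" for k
  have bound: "k \<le> len w" if "P k" for k using that by (auto simp: P_def)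
  have P1: "P 1"
    unfolding P_def
  proof (intro bexI conjI)
    show "w \<circ> reflection t \<in> cox_group" using assms by simp
    show "w = w \<circ> reflection t \<circ> act (alt_end s t 1)"
      using assms by (simp add: alt_letter_def)
    show "len w = len (w \<circ> reflection t) + 1"
      using len_comp_reflection(2)[OF assms(1,3)] assms(4) by simp
  qed
  define k where "k = (GREATEST k. P k)"
  have Pk: "P k" unfolding k_def using P1 bound by (rule GreatestI_nat)
  have max: "j \<le> k" if "P j" for j unfolding k_def using that bound by (rule Greatest_le_nat)
  have k: "0 < k" using max[OF P1] by simp
  obtain v where v: "v \<in> cox_group" "w = v \<circ> act (alt_end s t k)" "len w = len v + k"
    using Pk by (auto simp: P_def)
  have up: "len v \<le> len (v \<circ> reflection (alt_letter s t k))"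
  proof (rule ccontr)
    let ?v = "v \<circ> reflection (alt_letter s t k)"
    have a: "alt_letter s t k \<in> I" using assms by (simp add: alt_letter_in)
    assume "\<not> ?thesis"
    then have "len v = Suc (len ?v)"
      using len_comp_reflection(2)[OF v(1) a] by simp
    moreover have "w = ?v \<circ> act (alt_end s t (Suc k))"
      using v(2) a by (simp add: comp_assoc[symmetric])
    ultimately have "P (Suc k)" using v(1,3) a by (auto simp: P_def)
    then show False using max by fastforce
  qed
  have up': "len v \<le> len (v \<circ> reflection (alt_letter s t (k - 1)))"
  proof -
    let ?v = "v \<circ> reflection (alt_letter s t (k - 1))"
    have a: "alt_letter s t (k - 1) \<in> I" using assms by (simp add: alt_letter_in)
    obtain j where j: "k = Suc j" using k by (cases k) auto
    have "w = ?v \<circ> act (alt_end s t (k - 1))" using v(2) j by (simp add: comp_assoc)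
    then have "len w \<le> len ?v + (k - 1)"
      using len_comp_act[of ?v "alt_end s t (k - 1)"] v(1) a assms(2,3)
      by (simp add: alt_end_in_lists)
    then show ?thesis using v(3) j by simp
  qed
  have "len v \<le> len (v \<circ> reflection s)" "len v \<le> len (v \<circ> reflection t)"
    using up up' k by (auto simp: alt_letter_def split: if_splits)
  then show thesis using that[OF v(1) k v(2,3)] by simp
qed

text \<open>
As long as the alternating word is shorter than \<open>m\<close>, the Chebyshev coefficients of the root are
nonnegative.
\<close>

lemma dihedral_root_nonneg:
  assumes "v \<in> cox_group" "s \<in> I" "t \<in> I" "s \<noteq> t" "{s, t} \<in> E \<Longrightarrow> k < m {s, t}"
    and "nonneg (v (\<alpha> s))" "nonneg (v (\<alpha> t))"
  shows "nonneg ((v \<circ> act (alt_end s t k)) (\<alpha> s))"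
proof -
  have "nonneg (v (\<alpha> (alt_letter s t n)))" for n
    using assms(6,7) by (simp add: alt_letter_def)
  moreover have "0 \<le> cheb (- cartan s t) k" "0 \<le> cheb (- cartan s t) (Suc k)"
    by (intro cheb_nonneg; use assms in fastforce)+
  ultimately show ?thesis
    using assms(1) by (simp add: act_alt_end_root[OF assms(2-4)] cox_lin nonneg_lin)
qed

text \<open>
The theorem of Tits. If \<open>w\<close> is not shortened by \<open>s\<close>, strip off a maximal suffix alternating
between \<open>s\<close> and some descent \<open>t\<close> of \<open>w\<close>. The remaining factor \<open>v\<close> is shorter, so \<open>v \<alpha>\<^sub>s\<close> and \<open>v \<alpha>\<^sub>t\<close> are
nonnegative by induction, and \<open>w \<alpha>\<^sub>s\<close> is a combination of them with Chebyshev coefficients. The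
suffix has fewer than \<open>m\<close> letters: otherwise the braid relation would turn its end into \<open>s\<close>.
\<close>

lemma root_nonneg_at_ascent:
  assumes "w \<in> cox_group" "s \<in> I" "len w \<le> len (w \<circ> reflection s)"
  shows "nonneg (w (\<alpha> s))"
  using assms
proof (induction "len w" arbitrary: w s rule: less_induct)
  case less
  show ?case
  proof (cases "len w = 0")
    case True
    then show ?thesis using less.prems by (simp add: len_zero_iff)
  next
    case False
    obtain u where u: "u \<in> lists I" "act u = w" "length u = len w"
      using less.prems(1) by (rule len_witness)
    obtain a t where a: "u = a @ [t]" using u False by (cases u rule: rev_cases) auto
    have t: "t \<in> I" "a \<in> lists I" using u a by auto
    have "w \<circ> reflection t = act a"
      using u(2) a t by (auto simp: act_snoc)
    then have lt: "len (w \<circ> reflection t) < len w"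
      using len_act_le[OF t(2)] u a by simp
    then have st: "s \<noteq> t" using less.prems by auto
    obtain v k where v: "v \<in> cox_group" "0 < k" "w = v \<circ> act (alt_end s t k)" "len w = len v + k"
      "len v \<le> len (v \<circ> reflection s)" "len v \<le> len (v \<circ> reflection t)"
      using dihedral_descent[OF less.prems(1,2) t(1) lt] by blast
    have pv: "nonneg (v (\<alpha> s))" "nonneg (v (\<alpha> t))"
      using less.hyps[of v] v less.prems(2) t(1) by auto
    have "k < m {s, t}" if e: "{s, t} \<in> E"
    proof (rule ccontr)
      assume "\<not> k < m {s, t}"
      then have "m {s, t} \<le> k" by simp
      from dihedral_truncate[OF less.prems(2) t(1) less.prems(1) this v(1,3,4)]
      obtain v' where v': "v' \<in> cox_group" "w = v' \<circ> act (alt_end s t (m {s, t}))"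
        "len w = len v' + m {s, t}" by blast
      obtain n where n: "m {s, t} = Suc n" using edgeD(4)[OF e] by (cases "m {s, t}") auto
      have "w = v' \<circ> act (alt_end t s (Suc n))"
        using v'(2) act_braid[OF e] n by simp
      then have "w \<circ> reflection s = v' \<circ> act (alt_end s t n)"
        unfolding alt_end_snoc act_snoc using less.prems(2) by (simp add: comp_assoc)
      then have "len (w \<circ> reflection s) \<le> len v' + n"
        using len_comp_act[OF v'(1), of "alt_end s t n"] less.prems(2) t
        by (simp add: alt_end_in_lists)
      then show False using less.prems(3) v'(3) n by simp
    qed
    then show ?thesis
      using dihedral_root_nonneg[OF v(1) less.prems(2) t(1) st _ pv] v(3) by simp
  qed
qed

lemma comp_reflection_root:
  assumes "w \<in> cox_group" "s \<in> I"
  shows "(w \<circ> reflection s) (\<alpha> s) = (\<lambda>k. - w (\<alpha> s) k)"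
  using assms by (simp add: reflection_simple_root_self cox_minus)

lemma root_nonpos_at_descent:
  assumes "w \<in> cox_group" "s \<in> I" "len (w \<circ> reflection s) \<le> len w"
  shows "nonneg (\<lambda>k. - w (\<alpha> s) k)"
  using root_nonneg_at_ascent[of "w \<circ> reflection s" s] assms comp_reflection_root[OF assms(1,2)] by simp

text \<open>
Either \<open>s\<close> does not shorten \<open>w\<close>, or it does not lengthen \<open>w\<close>; in the second case the previous
argument applies to \<open>w s\<close>, which sends \<open>\<alpha>\<^sub>s\<close> to the opposite root.
\<close>

lemma root_sign:
  assumes "w \<in> cox_group" "s \<in> I" obtains "nonneg (w (\<alpha> s))" | "nonneg (\<lambda>k. - w (\<alpha> s) k)"
  using root_nonneg_at_ascent[OF assms] root_nonpos_at_descent[OF assms] by linarith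

lemma root_not_nonneg_and_nonpos:
  assumes "w \<in> cox_group" "s \<in> I" "nonneg (w (\<alpha> s))" "nonneg (\<lambda>k. - w (\<alpha> s) k)" shows False
  using nonneg_antisym[OF assms(3,4)] root_nonzero[OF assms(1,2)] by simp

lemma len_ascent:
  assumes "w \<in> cox_group" "s \<in> I" "nonneg (w (\<alpha> s))"
  shows "len (w \<circ> reflection s) = Suc (len w)"
  using root_nonpos_at_descent[OF assms(1,2)] root_not_nonneg_and_nonpos[OF assms]
    len_comp_reflection(1)[OF assms(1,2)]
  by force

lemma len_descent:
  assumes "w \<in> cox_group" "s \<in> I" "\<not> nonneg (w (\<alpha> s))"
  shows "len w = Suc (len (w \<circ> reflection s))"
  using root_nonneg_at_ascent[OF assms(1,2)] assms(3) len_comp_reflection(2)[OF assms(1,2)]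
  by force

section \<open>Reduced words and Matsumoto's theorem\<close>

definition reduced :: "'v list \<Rightarrow> bool" where
  "reduced u \<longleftrightarrow> u \<in> lists I \<and> len (act u) = length u"

lemma reduced_witness:
  assumes "w \<in> cox_group" obtains u where "reduced u" "act u = w"
  using len_witness[OF assms] by (metis reduced_def)

lemma reduced_prefix:
  assumes "reduced (u @ [s])" shows "reduced u"
proof -
  have "u \<in> lists I" "s \<in> I" using assms by (auto simp: reduced_def)
  then show ?thesis
    using assms len_comp_reflection(1)[of "act u" s] len_act_le[of u]
    by (auto simp: reduced_def act_snoc)
qed

lemma reduced_snoc:
  assumes "reduced u" "s \<in> I" "nonneg (act u (\<alpha> s))"
  shows "reduced (u @ [s])"
  using assms len_ascent[of "act u" s] by (auto simp: reduced_def act_snoc)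

abbreviation artin_eq :: "'v word \<Rightarrow> 'v word \<Rightarrow> bool" (infix "\<simeq>" 50) where
  "u \<simeq> v \<equiv> (u, v) \<in> pres_rel I (braid_relations E m)"

lemma artin_eq_alt_end:
  assumes "{s, t} \<in> E"
  shows "positive (alt_end s t (m {s, t})) \<simeq> positive (alt_end t s (m {s, t}))"
proof -
  have "(alt_word s t (m {s, t}), alt_word t s (m {s, t})) \<in> braid_relations E m"
    using assms by (auto simp: braid_relations_def insert_commute)
  moreover have "alt_word s t (m {s, t}) \<in> words I" "alt_word t s (m {s, t}) \<in> words I"
    using edgeD[OF assms] by (auto simp: alt_word_eq_alt_end positive_in_words alt_end_in_lists)
  ultimately have "alt_word s t (m {s, t}) \<simeq> alt_word t s (m {s, t})"
    using pres_rel.relator[of _ _ _ I "[]" "[]"] by fastforce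
  then show ?thesis
    by (auto simp: alt_word_eq_alt_end intro: pres_rel.sym split: if_splits)
qed

text \<open>
The length of the maximal suffix alternating between two descents reaches \<open>m\<close>, since a shorter
suffix would make \<open>w \<alpha>\<^sub>s\<close> nonnegative.
\<close>

lemma two_descents:
  assumes "w \<in> cox_group" "s \<in> I" "t \<in> I" "s \<noteq> t"
    and "len (w \<circ> reflection s) < len w" "len (w \<circ> reflection t) < len w"
  obtains v where "{s, t} \<in> E" "v \<in> cox_group" "w = v \<circ> act (alt_end s t (m {s, t}))"
    "len w = len v + m {s, t}"
proof -
  obtain v k where v: "v \<in> cox_group" "0 < k" "w = v \<circ> act (alt_end s t k)" "len w = len v + k"
    "len v \<le> len (v \<circ> reflection s)" "len v \<le> len (v \<circ> reflection t)"
    using dihedral_descent[OF assms(1-3) assms(6)] by blast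
  have "\<not> nonneg (w (\<alpha> s))"
    using root_nonpos_at_descent[OF assms(1,2)] root_not_nonneg_and_nonpos[OF assms(1,2)] assms(5) by auto
  then have "{s, t} \<in> E \<and> m {s, t} \<le> k"
    using dihedral_root_nonneg[OF v(1) assms(2-4)] root_nonneg_at_ascent[OF v(1)] v assms(2,3)
    by (meson not_less)
  moreover from this obtain v' where "v' \<in> cox_group" "w = v' \<circ> act (alt_end s t (m {s, t}))"
    "len w = len v' + m {s, t}"
    using dihedral_truncate[OF assms(2,3,1) _ v(1,3,4)] by blast
  ultimately show thesis using that by blast
qed

text \<open>
Induction on the length. If the last letters \<open>s\<close> and \<open>t\<close> differ, then both are descents, so the
element has a reduced expression ending in the long alternating word in \<open>s\<close> and \<open>t\<close>. By induction
each of the given words is equivalent to such an expression with its own last letter,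
and one braid relation connects the two.
\<close>

theorem matsumoto:
  assumes "reduced u" "reduced u'" "act u = act u'"
  shows "positive u \<simeq> positive u'"
  using assms
proof (induction "length u" arbitrary: u u' rule: less_induct)
  case less
  have len_eq: "length u = length u'" using less.prems by (simp add: reduced_def)
  have lists: "u \<in> lists I" "u' \<in> lists I" using less.prems by (auto simp: reduced_def)
  show ?case
  proof (cases u rule: rev_cases)
    case Nil
    then show ?thesis using len_eq by (auto intro: pres_rel.refl)
  next
    case u: (snoc a s)
    obtain b t where u': "u' = b @ [t]" using len_eq u by (cases u' rule: rev_cases) auto
    have st: "s \<in> I" "t \<in> I" "a \<in> lists I" "b \<in> lists I" using lists u u' by auto
    have red: "reduced a" "reduced b" using less.prems u u' by (auto intro: reduced_prefix)
    define w where "w = act u"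
    have w: "w \<in> cox_group" "len w = Suc (length a)" "length b = length a"
      using lists less.prems u u' len_eq by (auto simp: w_def reduced_def)
    have wa: "w \<circ> reflection s = act a" using st by (simp add: w_def u act_snoc)
    have wb: "w \<circ> reflection t = act b"
      using st by (simp add: w_def less.prems(3) u' act_snoc)
    have snoc_eq: "positive (c @ [r]) \<simeq> positive (d @ [r])"
      if "positive c \<simeq> positive d" "r \<in> I" for c d r
      using pres_rel_append[OF that(1) pres_rel.refl[of "positive [r]"]] that(2) by simp
    show ?thesis
    proof (cases "s = t")
      case True
      then have "positive a \<simeq> positive b"
        using less.hyps[of a b] red u wa wb by simp
      then show ?thesis using snoc_eq st True u u' by blast
    next
      case False
      obtain v where v: "{s, t} \<in> E" "v \<in> cox_group" "w = v \<circ> act (alt_end s t (m {s, t}))"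
        "len w = len v + m {s, t}"
        using two_descents[OF w(1) st(1,2) False] red wa wb w by (auto simp: reduced_def)
      obtain p where p: "reduced p" "act p = v" using v(2) by (rule reduced_witness)
      obtain n where n: "m {s, t} = Suc n" using edgeD(4)[OF v(1)] by (cases "m {s, t}") auto
      have p_words: "p \<in> lists I" using p by (simp add: reduced_def)
      have wt: "w = act (p @ alt_end t s n @ [t])" and ws: "w = act (p @ alt_end s t n @ [s])"
        using v(3) p(2) n act_braid[OF v(1)]
        by (simp_all add: act_append alt_end_snoc[symmetric] del: alt_end.simps)
      have "act (p @ alt_end t s n) = w \<circ> reflection t"
        unfolding wt using st by (simp add: act_append comp_assoc)
      moreover have "act (p @ alt_end s t n) = w \<circ> reflection s"
        unfolding ws using st by (simp add: act_append comp_assoc)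
      ultimately have acts: "act (p @ alt_end t s n) = act b" "act (p @ alt_end s t n) = act a"
        using wa wb by auto
      have "length p + n = length a" using v(4) n w(2) p by (simp add: reduced_def)
      then have "reduced (p @ alt_end t s n)" "reduced (p @ alt_end s t n)"
        using acts red p_words st w(3) by (auto simp: reduced_def alt_end_in_lists)
      then have "positive b \<simeq> positive (p @ alt_end t s n)"
        and "positive a \<simeq> positive (p @ alt_end s t n)"
        using less.hyps[of b "p @ alt_end t s n"] less.hyps[of a "p @ alt_end s t n"] acts red u w(3)
        by simp_all
      then have "positive u' \<simeq> positive p @ positive (alt_end s t (m {s, t}))"
        and "positive u \<simeq> positive p @ positive (alt_end t s (m {s, t}))"
        using snoc_eq[of b "p @ alt_end t s n" t] snoc_eq[of a "p @ alt_end s t n" s] st u u' n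
        by (simp_all add: alt_end_snoc del: alt_end.simps)
      moreover have "positive p @ positive (alt_end s t (m {s, t})) \<simeq>
          positive p @ positive (alt_end t s (m {s, t}))"
        by (intro pres_rel_append artin_eq_alt_end v(1) pres_rel.refl)
           (simp add: positive_in_words p_words)
      ultimately show ?thesis by (meson pres_rel.sym pres_rel.trans)
    qed
  qed
qed

end

lemma alt_word_in_words: "i \<in> S \<Longrightarrow> j \<in> S \<Longrightarrow> alt_word i j n \<in> words S"
  by (induction n arbitrary: i j) auto

text \<open>
Alternating words read from the left, with the starting letter recorded by its parity; splitting
such a word shifts the parity by the length of the first part.
\<close>

lemma alt_word_add:
  "alt_word (alt_letter i j s) (alt_letter i j (Suc s)) (p + q) =
    alt_word (alt_letter i j s) (alt_letter i j (Suc s)) p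
    @ alt_word (alt_letter i j (s + p)) (alt_letter i j (Suc (s + p))) q"
proof (induction p arbitrary: s)
  case (Suc p)
  show ?case using Suc.IH[of "Suc s"] by simp
qed simp

lemma rev_alt_end: "rev (alt_end s t n) = (if even n then alt_end t s n else alt_end s t n)"
proof (induction n)
  case (Suc n)
  have "rev (alt_end s t (Suc n)) = rev (alt_end s t n) @ [alt_letter s t n]" by simp
  also have "\<dots> = (if even (Suc n) then alt_end t s (Suc n) else alt_end s t (Suc n))"
    unfolding Suc.IH by (simp add: alt_letter_def alt_end_snoc del: alt_end.simps)
  finally show ?case .
qed simp

context artin_graph
begin

text \<open>
A sum of nonnegative vectors lies on a coordinate axis only if each summand does.
\<close>

lemma nonneg_combination_simple:
  assumes "v \<in> cox_group" "Y \<subseteq> I" "x \<in> I" "\<And>y. y \<in> Y \<Longrightarrow> nonneg (v (\<alpha> y))" "\<And>y. y \<in> Y \<Longrightarrow> 0 \<le> a y"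
    and "v (\<lambda>k. \<Sum>y\<in>Y. a y * \<alpha> y k) = \<alpha> x" "y \<in> Y" "a y \<noteq> 0"
  shows "v (\<alpha> y) = \<alpha> x"
proof (rule nonneg_root_multiple_simple[OF assms(1) _ assms(3)])
  show "y \<in> I" "nonneg (v (\<alpha> y))" using assms by auto
  fix k assume "k \<noteq> x"
  have fin: "finite Y" using assms(2) finite_I finite_subset by blast
  have "(\<Sum>y\<in>Y. a y * v (\<alpha> y) k) = 0"
    using assms(6) \<open>k \<noteq> x\<close> unfolding cox_sum[OF assms(1) fin]
    by (auto simp: simple_root_def dest: fun_cong[of _ _ k])
  moreover have "0 \<le> a y * v (\<alpha> y) k" if "y \<in> Y" for y
    using assms(4,5)[OF that] by (simp add: nonneg_def)
  ultimately have "a y * v (\<alpha> y) k = 0"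
    using fin assms(7) by (simp add: sum_nonneg_eq_0_iff)
  then show "v (\<alpha> y) k = 0" using assms(8) by simp
qed

lemma act_support:
  assumes "u \<in> lists Y" "\<And>k. k \<notin> Y \<Longrightarrow> f k = 0" "k \<notin> Y"
  shows "act u f k = 0"
  using assms by (induction u) (auto simp: reflection_def simple_root_def)

text \<open>
If \<open>v\<close> is minimal in \<open>v W\<^sub>Y\<close>, then it sends simple roots of \<open>Y\<close> to nonnegative roots, so a root of
\<open>W\<^sub>Y\<close> can be sent to a simple root only if already a simple root of \<open>Y\<close> is. This replaces the
description of \<open>W\<^sub>X \<inter> v W\<^sub>Y v\<inverse>\<close> as a standard parabolic subgroup.
\<close>

lemma simple_root_from_parabolic:
  assumes "v \<in> cox_group" "Y \<subseteq> I" "x \<in> I" "\<And>y. y \<in> Y \<Longrightarrow> nonneg (v (\<alpha> y))"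
    and "g \<in> lists Y" "s \<in> Y" "(v \<circ> act g) (\<alpha> s) = \<alpha> x"
  shows "\<exists>y\<in>Y. v (\<alpha> y) = \<alpha> x"
proof -
  define f where "f = act g (\<alpha> s)"
  have fin: "finite Y" using assms(2) finite_I finite_subset by blast
  have supp: "f k = 0" if "k \<notin> Y" for k
    unfolding f_def
    by (rule act_support[OF assms(5) _ that]) (use assms(6) in \<open>auto simp: simple_root_def\<close>)
  have f: "f = (\<lambda>k. \<Sum>y\<in>Y. f y * \<alpha> y k)"
  proof
    fix k
    have "(\<Sum>y\<in>Y. f y * \<alpha> y k) = (\<Sum>y\<in>Y. if y = k then f k else 0)"
      by (rule sum.cong) (auto simp: simple_root_def)
    then show "f k = (\<Sum>y\<in>Y. f y * \<alpha> y k)" using fin supp by simp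
  qed
  have vf: "v f = \<alpha> x" using assms(7) by (simp add: f_def)
  then have vf': "v (\<lambda>k. \<Sum>y\<in>Y. f y * \<alpha> y k) = \<alpha> x" using f by simp
  have "g \<in> lists I" using assms(2,5) by auto
  then have g: "act g \<in> cox_group" "s \<in> I" using assms(2,6) by auto
  show ?thesis
  proof (rule root_sign[OF g])
    assume "nonneg (act g (\<alpha> s))"
    then have "0 \<le> f y" for y by (simp add: nonneg_def f_def)
    moreover have "\<exists>y\<in>Y. f y \<noteq> 0"
      using supp root_nonzero[OF g] by (auto simp: f_def fun_eq_iff)
    ultimately show ?thesis
      using nonneg_combination_simple[OF assms(1-4) _ vf'] by blast
  next
    assume "nonneg (\<lambda>k. - act g (\<alpha> s) k)"
    then have neg: "f y \<le> 0" for y by (simp add: nonneg_def f_def)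
    have "1 = (\<Sum>y\<in>Y. f y * v (\<alpha> y) x)"
      using fun_cong[OF vf', of x] by (simp add: cox_sum[OF assms(1) fin]) (simp add: simple_root_def)
    also have "\<dots> \<le> 0"
      using assms(4) neg by (intro sum_nonpos mult_nonpos_nonneg) (auto simp: nonneg_def)
    finally show ?thesis by simp
  qed
qed

section \<open>Minimal coset representatives and the cocycle of a parabolic subgroup\<close>

text \<open>
The minimal representatives of the cosets \<open>W\<^sub>X w\<close>, described by \<open>w\<inverse> \<alpha>\<^sub>x \<ge> 0\<close> for \<open>x \<in> X\<close>. The
quantified vector \<open>f\<close> stands for \<open>w\<inverse> \<alpha>\<^sub>x\<close>.
\<close>

definition coset_reps :: "'v set \<Rightarrow> (('v \<Rightarrow> real) \<Rightarrow> 'v \<Rightarrow> real) set" where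
  "coset_reps X = {w \<in> cox_group. \<forall>x\<in>X. \<forall>f. w f = \<alpha> x \<longrightarrow> nonneg f}"

lemma coset_reps_cox: "w \<in> coset_reps X \<Longrightarrow> w \<in> cox_group"
  by (simp add: coset_reps_def)

lemma id_in_coset_reps [simp]: "id \<in> coset_reps X"
  by (auto simp: coset_reps_def)

text \<open>
The only nonnegative root that a simple reflection \<open>s\<close> makes nonpositive is \<open>\<alpha>\<^sub>s\<close>, because the
other coordinates of a root are left unchanged. So if \<open>w s\<close> is no longer minimal, the
offending root \<open>w\<inverse> \<alpha>\<^sub>x\<close> is \<open>\<alpha>\<^sub>s\<close>.
\<close>

lemma coset_reps_leave:
  assumes "w \<in> coset_reps X" "X \<subseteq> I" "s \<in> I" "w \<circ> reflection s \<notin> coset_reps X"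
  obtains x where "x \<in> X" "w (\<alpha> s) = \<alpha> x"
proof -
  have w: "w \<in> cox_group" using assms(1) by (rule coset_reps_cox)
  obtain x f where x: "x \<in> X" "w (reflection s f) = \<alpha> x" "\<not> nonneg f"
    using assms w by (auto simp: coset_reps_def)
  have xI: "x \<in> I" using x assms by auto
  obtain u where u: "u \<in> lists I" "w = act u" using w by (rule coxE)
  define v where "v = act (rev u)"
  have v: "v \<in> cox_group" "act (s # rev u) \<in> cox_group"
    unfolding v_def using u(1) assms(3) by (intro act_in_cox; auto)+
  have wv: "w (v (\<alpha> x)) = \<alpha> x" using act_rev(1)[OF u(1)] by (simp add: u v_def)
  have beta: "reflection s f = v (\<alpha> x)" using cox_eqD[OF w] x(2) wv by metis
  have f: "f = act (s # rev u) (\<alpha> x)"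
    using reflection_reflection[OF assms(3), of f] beta by (simp add: v_def)
  have nonneg: "nonneg (v (\<alpha> x))" using assms(1) x(1) wv by (auto simp: coset_reps_def)
  have neg: "nonneg (\<lambda>k. - f k)" using root_sign[OF v(2) xI] f x(3) by metis
  have "v (\<alpha> x) k = 0" if "k \<noteq> s" for k
  proof -
    have "f k = reflection s f k" using that by (simp add: reflection_def simple_root_def)
    then have "f k = v (\<alpha> x) k" using beta by simp
    then show ?thesis using nonneg neg unfolding nonneg_def by (metis neg_0_le_iff_le order_antisym)
  qed
  then have "v (\<alpha> x) = \<alpha> s"
    using nonneg_root_multiple_simple[OF v(1) xI assms(3) nonneg] by blast
  then show thesis using that x(1) wv by simp
qed

lemma coset_reps_stay:
  assumes "s \<in> I" "x \<in> X" "w (\<alpha> s) = \<alpha> x"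
  shows "w \<circ> reflection s \<notin> coset_reps X"
proof
  assume "w \<circ> reflection s \<in> coset_reps X"
  moreover have "(w \<circ> reflection s) (reflection s (\<alpha> s)) = \<alpha> x"
    using assms by (simp add: reflection_reflection)
  ultimately have "nonneg (reflection s (\<alpha> s))" using assms(2) by (auto simp: coset_reps_def)
  then show False using assms(1) by (simp add: reflection_simple_root_self)
qed

lemma coset_reps_descent:
  assumes "w \<in> coset_reps X" "X \<subseteq> I" "s \<in> I" "\<not> nonneg (w (\<alpha> s))"
  shows "w \<circ> reflection s \<in> coset_reps X"
  using coset_reps_leave[OF assms(1-3)] assms(4) by (metis nonneg_simple_root)

definition step :: "'v set \<Rightarrow> (('v \<Rightarrow> real) \<Rightarrow> 'v \<Rightarrow> real) \<Rightarrow> 'v \<Rightarrow> ('v \<Rightarrow> real) \<Rightarrow> 'v \<Rightarrow> real" where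
  "step X w s = (if w \<circ> reflection s \<in> coset_reps X then w \<circ> reflection s else w)"

text \<open>
The index \<open>x\<close> is unique, as distinct vertices have distinct simple roots. It lies in \<open>X\<close> when \<open>w\<close>
is a minimal representative and \<open>w s\<close> is not.
\<close>

definition emitted :: "'v set \<Rightarrow> (('v \<Rightarrow> real) \<Rightarrow> 'v \<Rightarrow> real) \<Rightarrow> 'v \<times> bool \<Rightarrow> 'v word" where
  "emitted X w l = (if w \<circ> reflection (fst l) \<in> coset_reps X then []
    else [(THE x. w (\<alpha> (fst l)) = \<alpha> x, snd l)])"

text \<open>
The action of words on coset representatives, and the word over \<open>X\<close> emitted on the way. Signs of
letters do not influence the state; an emitted letter inherits the sign.
\<close>

primrec state :: "'v set \<Rightarrow> (('v \<Rightarrow> real) \<Rightarrow> 'v \<Rightarrow> real) \<Rightarrow> 'v word \<Rightarrow> ('v \<Rightarrow> real) \<Rightarrow> 'v \<Rightarrow> real" where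
  "state X w [] = w"
| "state X w (l # u) = state X (step X w (fst l)) u"

primrec cocycle :: "'v set \<Rightarrow> (('v \<Rightarrow> real) \<Rightarrow> 'v \<Rightarrow> real) \<Rightarrow> 'v word \<Rightarrow> 'v word" where
  "cocycle X w [] = []"
| "cocycle X w (l # u) = emitted X w l @ cocycle X (step X w (fst l)) u"

lemma step_move [simp]:
  assumes "w \<circ> reflection s \<in> coset_reps X"
  shows "step X w s = w \<circ> reflection s" "emitted X w (s, e) = []"
  using assms by (simp_all add: step_def emitted_def)

lemma step_loop:
  assumes "s \<in> I" "x \<in> X" "w (\<alpha> s) = \<alpha> x"
  shows "step X w s = w" "emitted X w (s, e) = [(x, e)]"
  using coset_reps_stay[of s x X w] assms by (auto simp: step_def emitted_def simple_root_eq_iff)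

lemma step_cases:
  assumes "w \<in> coset_reps X" "X \<subseteq> I" "s \<in> I"
  obtains "w \<circ> reflection s \<in> coset_reps X" "step X w s = w \<circ> reflection s" "\<And>e. emitted X w (s, e) = []"
  | x where "x \<in> X" "w (\<alpha> s) = \<alpha> x" "step X w s = w" "\<And>e. emitted X w (s, e) = [(x, e)]"
proof (cases "w \<circ> reflection s \<in> coset_reps X")
  case True
  then show thesis using that(1) by simp
next
  case False
  then obtain x where x: "x \<in> X" "w (\<alpha> s) = \<alpha> x" using coset_reps_leave[OF assms] by blast
  then show thesis using that(2) step_loop[of s x X w] assms(3) x by blast
qed

lemma step_in_coset_reps:
  assumes "w \<in> coset_reps X" shows "step X w s \<in> coset_reps X"
  using assms by (simp add: step_def)

lemma state_in_coset_reps: "w \<in> coset_reps X \<Longrightarrow> state X w u \<in> coset_reps X"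
  by (induction u arbitrary: w) (auto simp: step_in_coset_reps)

lemma state_append: "state X w (u @ v) = state X (state X w u) v"
  by (induction u arbitrary: w) auto

lemma cocycle_append: "cocycle X w (u @ v) = cocycle X w u @ cocycle X (state X w u) v"
  by (induction u arbitrary: w) auto

lemma cocycle_in_words:
  assumes "X \<subseteq> I"
  shows "w \<in> coset_reps X \<Longrightarrow> u \<in> words I \<Longrightarrow> cocycle X w u \<in> words X"
proof (induction u arbitrary: w)
  case (Cons l u)
  obtain s e where l: "l = (s, e)" by force
  have "s \<in> I" using Cons.prems l by simp
  with Cons.prems(1) assms show ?case
    by (rule step_cases) (use Cons l in auto)
qed simp

lemma words_mono: "u \<in> words X \<Longrightarrow> X \<subseteq> Y \<Longrightarrow> u \<in> words Y"
  by (auto simp: words_def)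

lemma step_cancel:
  assumes "w \<in> coset_reps X" "X \<subseteq> I" "s \<in> I"
  shows "step X (step X w s) s = w"
    and "cocycle X w [(s, e), (s, \<not> e)] \<simeq> []"
  using assms
proof (atomize (full), rule step_cases, goal_cases)
  case 1
  then show ?case using assms by (auto simp: step_def emitted_def intro: pres_rel.refl)
next
  case (2 x)
  moreover from this have "[(x, e), (x, \<not> e)] \<simeq> []"
    using pres_rel.cancel[of x I "[]" "[]" e] assms by auto
  ultimately show ?case by simp
qed

text \<open>
Stripping descents from \<open>Y\<close> stays among the representatives and shortens the element, hence ends
at one that is minimal on the right. All these steps move, so reading the word backwards returns
to the starting point.
\<close>

lemma state_descend:
  assumes "X \<subseteq> I" "Y \<subseteq> I"
  shows "w \<in> coset_reps X \<Longrightarrow> \<exists>u\<in>lists Y. (\<forall>y\<in>Y. nonneg (state X w (positive u) (\<alpha> y)))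
    \<and> state X (state X w (positive u)) (positive (rev u)) = w"
proof (induction "len w" arbitrary: w rule: less_induct)
  case less
  show ?case
  proof (cases "\<forall>y\<in>Y. nonneg (w (\<alpha> y))")
    case True
    then show ?thesis by (intro bexI[of _ "[]"]) auto
  next
    case False
    then obtain y where y: "y \<in> Y" "\<not> nonneg (w (\<alpha> y))" by blast
    have yI: "y \<in> I" using y assms by auto
    let ?w = "w \<circ> reflection y"
    have w: "?w \<in> coset_reps X" by (rule coset_reps_descent[OF less.prems assms(1) yI y(2)])
    have "len ?w < len w"
      using len_descent[OF coset_reps_cox[OF less.prems] yI y(2)] by simp
    from less.hyps[OF this w] obtain u where u: "u \<in> lists Y"
      "\<forall>y\<in>Y. nonneg (state X ?w (positive u) (\<alpha> y))"
      "state X (state X ?w (positive u)) (positive (rev u)) = ?w" by blast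
    have "step X ?w y = w" using less.prems yI by (simp add: step_def)
    then show ?thesis
      using u y w by (intro bexI[of _ "y # u"]) (auto simp: state_append)
  qed
qed

lemma state_invariant_set:
  assumes "\<And>v s. v \<in> S \<Longrightarrow> s \<in> Y \<Longrightarrow> step X v s \<in> S"
  shows "v \<in> S \<Longrightarrow> u \<in> lists Y \<Longrightarrow> state X v (positive u) \<in> S"
  by (induction u arbitrary: v) (auto simp: assms)

text \<open>
If \<open>v\<close> is minimal on the right for \<open>Y\<close> and sends no simple root of \<open>Y\<close> to one of \<open>X\<close>, then \<open>v W\<^sub>Y\<close>
consists of representatives and all steps by letters of \<open>Y\<close> move.
\<close>

lemma moves_without_matched_root:
  assumes "X \<subseteq> I" "Y \<subseteq> I" "v \<in> coset_reps X" "\<And>y. y \<in> Y \<Longrightarrow> nonneg (v (\<alpha> y))"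
    and "\<And>x y. x \<in> X \<Longrightarrow> y \<in> Y \<Longrightarrow> v (\<alpha> y) \<noteq> \<alpha> x"
  shows "v \<circ> act g \<in> coset_reps X \<Longrightarrow> g \<in> lists Y \<Longrightarrow> u \<in> words Y \<Longrightarrow>
    state X (v \<circ> act g) u = v \<circ> act (g @ map fst u) \<and> cocycle X (v \<circ> act g) u = []"
proof (induction u arbitrary: g)
  case (Cons l u)
  obtain s e where l: "l = (s, e)" by force
  have s: "s \<in> Y" using Cons.prems l by simp
  have sI: "s \<in> I" using s assms(2) by auto
  have v: "v \<in> cox_group" using assms(3) by (rule coset_reps_cox)
  have move: "v \<circ> act g \<circ> reflection s \<in> coset_reps X"
  proof (rule ccontr)
    assume "\<not> ?thesis"
    with Cons.prems(1) assms(1) sI obtain x where x: "x \<in> X" "(v \<circ> act g) (\<alpha> s) = \<alpha> x"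
      by (rule coset_reps_leave)
    then show False
      using simple_root_from_parabolic[OF v assms(2) _ assms(4) Cons.prems(2) s] assms(1,5)
      by blast
  qed
  have eq: "v \<circ> act g \<circ> reflection s = v \<circ> act (g @ [s])"
    by (simp add: act_append comp_assoc)
  have "state X (v \<circ> act (g @ [s])) u = v \<circ> act ((g @ [s]) @ map fst u)
    \<and> cocycle X (v \<circ> act (g @ [s])) u = []"
  proof (rule Cons.IH)
    show "v \<circ> act (g @ [s]) \<in> coset_reps X" using move eq by simp
  qed (use Cons.prems s in auto)
  then show ?case
    unfolding l state.simps cocycle.simps fst_conv step_move[OF move] eq by simp
qed simp

lemma cocycle_both_loops:
  assumes "i \<in> I" "j \<in> I" "x \<in> X" "y \<in> X" "v (\<alpha> i) = \<alpha> x" "v (\<alpha> j) = \<alpha> y"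
  shows "state X v (alt_word i j n) = v" "cocycle X v (alt_word i j n) = alt_word x y n"
proof -
  have "state X v (alt_word i j n) = v \<and> cocycle X v (alt_word i j n) = alt_word x y n"
    using assms by (induction n arbitrary: i j x y) (simp_all add: step_loop)
  then show "state X v (alt_word i j n) = v" "cocycle X v (alt_word i j n) = alt_word x y n"
    by auto
qed

text \<open>
Labels can be recovered from the entries because the cosine is injective on \<open>[0, \<pi>]\<close> and only a
missing edge gives \<open>- 2\<close>.
\<close>

lemma cartan_determines_edge:
  assumes "{i, j} \<in> E" "x \<noteq> y" "cartan x y = cartan i j"
  shows "{x, y} \<in> E" "m {x, y} = m {i, j}"
proof -
  note e = edgeD[OF assms(1)]
  have ij: "cartan i j = - 2 * cos (pi / real (m {i, j}))" using assms(1) e by (simp add: cartan_def)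
  show xy: "{x, y} \<in> E"
    using cos_pi_over_less_one[OF e(4)] assms(2,3) ij by (auto simp: cartan_def split: if_splits)
  have m2: "2 \<le> m {x, y}" using edgeD(4)[OF xy] .
  have "cos (pi / real (m {x, y})) = cos (pi / real (m {i, j}))"
    using xy assms(2,3) ij by (simp add: cartan_def)
  moreover have "0 \<le> pi / real n \<and> pi / real n \<le> pi" if "2 \<le> n" for n :: nat
    using that by (simp add: divide_le_eq)
  ultimately have "pi / real (m {x, y}) = pi / real (m {i, j})"
    using e(4) m2 cos_inj_pi by blast
  then show "m {x, y} = m {i, j}" by simp
qed

text \<open>
Suppose that \<open>v\<close> sends exactly one of \<open>\<alpha>\<^sub>i\<close>, \<open>\<alpha>\<^sub>j\<close> to a simple root of \<open>X\<close>, namely \<open>\<alpha>\<^sub>i\<close> to \<open>\<alpha>\<^sub>x\<close>. Then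
the representatives in \<open>v W\<^sub>i\<^sub>j\<close> form a chain of \<open>m\<close> elements that starts at \<open>v\<close> with a step by \<open>j\<close>
and alternates. The remaining letter at either end fixes the state and emits \<open>x\<close>: the root
in question is \<open>U\<^sub>n\<^sub>+\<^sub>1 \<alpha>\<^sub>j + U\<^sub>n \<alpha>\<^sub>i\<close>, and its first coefficient is zero exactly at the far end.
\<close>

lemma one_loop_chain:
  assumes "{i, j} \<in> E" "X \<subseteq> I" "v \<in> coset_reps X" "x \<in> X"
    and "v (\<alpha> i) = \<alpha> x" "nonneg (v (\<alpha> j))" "\<forall>y\<in>X. v (\<alpha> j) \<noteq> \<alpha> y"
  defines "a \<equiv> alt_letter i j" and "q \<equiv> \<lambda>n. v \<circ> act (rev (alt_end i j n))"
  shows "\<And>n. n < m {i, j} \<Longrightarrow> q n \<in> coset_reps X"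
    and "q (m {i, j} - 1) (\<alpha> (a (m {i, j} - 1))) = \<alpha> x"
    and "\<And>n. q (Suc n) = q n \<circ> reflection (a n)"
    and "\<And>n. q (Suc n) \<circ> reflection (a n) = q n"
proof -
  note e = edgeD[OF assms(1)]
  have v: "v \<in> cox_group" using assms(3) by (rule coset_reps_cox)
  let ?U = "cheb (- cartan i j)"
  have a: "a n \<in> I" for n using e by (simp add: a_def alt_letter_in)
  show q_Suc: "q (Suc n) = q n \<circ> reflection (a n)" for n
    by (simp add: q_def a_def act_append comp_assoc)
  then show "q (Suc n) \<circ> reflection (a n) = q n" for n using a by simp
  have root: "q n (\<alpha> (a n)) = v (\<lambda>k. ?U (Suc n) * \<alpha> j k + ?U n * \<alpha> i k)" for n
  proof (cases "even n")
    case True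
    then show ?thesis
      using act_alt_end_root[OF e(2,1) e(3)[symmetric], of n]
      by (simp add: q_def a_def rev_alt_end alt_letter_def cartan_commute[of j i])
  next
    case False
    then show ?thesis
      using act_alt_end_root[OF e(1,2,3), of n]
      by (simp add: q_def a_def rev_alt_end alt_letter_def)
  qed
  show "q n \<in> coset_reps X" if "n < m {i, j}" for n
    using that
  proof (induction n)
    case 0
    then show ?case using assms(3) by (simp add: q_def)
  next
    case (Suc n)
    show ?case
    proof (rule ccontr)
      assume "q (Suc n) \<notin> coset_reps X"
      then obtain y where y: "y \<in> X" "q n (\<alpha> (a n)) = \<alpha> y"
        using coset_reps_leave[of "q n" X "a n"] Suc assms(2) a by (auto simp: q_Suc)
      define c where "c k = (if k = j then ?U (Suc n) else ?U n)" for k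
      have "v (\<alpha> j) = \<alpha> y"
      proof (rule nonneg_combination_simple[OF v, of "{i, j}" y c])
        show "v (\<lambda>k. \<Sum>l\<in>{i, j}. c l * \<alpha> l k) = \<alpha> y"
          using y(2) e(3) by (simp add: root c_def add.commute)
        show "c j \<noteq> 0" using cheb_edge(1)[OF assms(1), of "Suc n"] Suc.prems by (simp add: c_def)
        show "0 \<le> c l" for l
          using cheb_nonneg[OF e(3), of n] cheb_nonneg[OF e(3), of "Suc n"] Suc.prems
          by (simp add: c_def del: cheb.simps)
      qed (use e y assms in auto)
      then show False using assms(7) y(1) by blast
    qed
  qed
  obtain n where n: "m {i, j} = Suc n" using e(4) by (cases "m {i, j}") auto
  have "q n (\<alpha> (a n)) = v (\<alpha> i)"
    using cheb_edge(2,3)[OF assms(1)] n by (simp add: root)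
  then show "q (m {i, j} - 1) (\<alpha> (a (m {i, j} - 1))) = \<alpha> x" using assms(5) n by simp
qed

text \<open>
From place \<open>n\<close> of the chain, one alternating word of length \<open>m\<close> runs to the far end, is delayed
there once and turns back; the other does the same at the near end. Both end at place
\<open>m - 1 - n\<close> and emit the single letter \<open>x\<close>.
\<close>

lemma braid_one_loop:
  assumes "{i, j} \<in> E" "X \<subseteq> I" "v \<in> coset_reps X" "x \<in> X"
    and "v (\<alpha> i) = \<alpha> x" "nonneg (v (\<alpha> j))" "\<forall>y\<in>X. v (\<alpha> j) \<noteq> \<alpha> y"
    and "u \<in> lists {i, j}"
  defines "w \<equiv> state X v (positive u)"
  shows "state X w (alt_word i j (m {i, j})) = state X w (alt_word j i (m {i, j}))"
    "cocycle X w (alt_word i j (m {i, j})) = cocycle X w (alt_word j i (m {i, j}))"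
proof -
  note e = edgeD[OF assms(1)]
  let ?M = "m {i, j}"
  define a where "a = alt_letter i j"
  define q where "q n = v \<circ> act (rev (alt_end i j n))" for n
  note chain = one_loop_chain[OF assms(1-7), folded a_def q_def]
  have a_I: "a n \<in> I" for n using e by (simp add: a_def alt_letter_in)
  have a_SS: "a (Suc (Suc n)) = a n" for n by (simp add: a_def)
  have a_cong: "a n = a k" if "even n \<longleftrightarrow> even k" for n k
    using that by (simp add: a_def alt_letter_def)
  have loop0: "q 0 (\<alpha> (a n)) = \<alpha> x" if "odd n" for n
    using that assms(5) by (simp add: q_def a_def alt_letter_def)
  have up: "step X (q n) (a n) = q (Suc n)" "emitted X (q n) (a n, True) = []" if "Suc n < ?M" for n
    using chain(1)[OF that] by (simp_all add: chain(3))
  have down: "step X (q (Suc n)) (a n) = q n" "emitted X (q (Suc n)) (a n, True) = []"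
    if "n < ?M" for n
    using chain(1)[OF that] by (simp_all add: chain(4))
  define W where "W n k = alt_word (a n) (a (Suc n)) k" for n k
  have W_Suc: "W n (Suc k) = (a n, True) # W (Suc n) k" for n k
    by (simp add: W_def a_SS)
  have W_add: "W n (k + l) = W n k @ W (n + k) l" for n k l
    by (simp add: W_def a_def alt_word_add)
  have W_cong: "W n k = W n' k" if "even n \<longleftrightarrow> even n'" for n n' k
    using a_cong[of n n'] a_cong[of "Suc n" "Suc n'"] that by (simp add: W_def)
  have forward: "state X (q n) (W n k) = q (n + k) \<and> cocycle X (q n) (W n k) = []"
    if "n + k < ?M" for n k
    using that
  proof (induction k arbitrary: n)
    case (Suc k)
    then show ?case using Suc.IH[of "Suc n"] up[of n] by (simp add: W_Suc)
  qed (simp add: W_def)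
  have backward: "state X (q n) (W (Suc n) k) = q (n - k) \<and> cocycle X (q n) (W (Suc n) k) = []"
    if "k \<le> n" "n < ?M" for n k
    using that
  proof (induction k arbitrary: n)
    case (Suc k)
    obtain n' where n': "n = Suc n'" using Suc.prems by (cases n) auto
    have "W (Suc (Suc n)) k = W (Suc n') k" using n' by (intro W_cong) simp
    then show ?case
      using Suc.IH[of n'] Suc.prems down[of n'] n' by (simp add: W_Suc a_SS)
  qed (simp add: W_def)
  have main: "state X (q n) (W n ?M) = q (?M - 1 - n) \<and> cocycle X (q n) (W n ?M) = [(x, True)]"
    "state X (q n) (W (Suc n) ?M) = q (?M - 1 - n) \<and> cocycle X (q n) (W (Suc n) ?M) = [(x, True)]"
    if n: "n < ?M" for n
  proof -
    define k where "k = ?M - 1 - n"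
    have M: "?M = k + Suc n" "?M - 1 = n + k" using n by (auto simp: k_def)
    \<comment> \<open>The letter by which the chain would continue beyond its far end.\<close>
    have top: "step X (q (n + k)) (a (n + k)) = q (n + k)"
      "emitted X (q (n + k)) (a (n + k), True) = [(x, True)]"
      using step_loop[of "a (n + k)" x X "q (n + k)"] chain(2) a_I assms(4) M(2) by auto
    \<comment> \<open>After \<open>n\<close> steps back the next letter has odd index, hence is \<open>i\<close>, the loop at the near end.\<close>
    have bottom: "step X (q 0) (a (Suc n + n)) = q 0"
      "emitted X (q 0) (a (Suc n + n), True) = [(x, True)]"
      using step_loop[of "a (Suc n + n)" x X "q 0"] loop0[of "Suc n + n"] a_I assms(4) by auto
    have "W n ?M = W n k @ (a (n + k), True) # W (Suc (n + k)) n"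
      by (simp only: M(1) W_add W_Suc)
    then show "state X (q n) (W n ?M) = q (?M - 1 - n) \<and> cocycle X (q n) (W n ?M) = [(x, True)]"
      using forward[of n k] backward[of n "n + k"] top M
      by (simp add: state_append cocycle_append k_def[symmetric])
    have "?M = n + Suc k" using M by simp
    then have "W (Suc n) ?M = W (Suc n) n @ (a (Suc n + n), True) # W (Suc (Suc n + n)) k"
      by (simp only: W_add W_Suc)
    moreover have "W (Suc (Suc n + n)) k = W 0 k" by (rule W_cong) simp
    ultimately show "state X (q n) (W (Suc n) ?M) = q (?M - 1 - n)
        \<and> cocycle X (q n) (W (Suc n) ?M) = [(x, True)]"
      using forward[of 0 k] backward[of n n] bottom M n
      by (simp add: state_append cocycle_append k_def[symmetric])
  qed
  have "w \<in> q ` {..<?M}"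
    unfolding w_def
  proof (rule state_invariant_set[OF _ _ assms(8)])
    show "v \<in> q ` {..<?M}" using e(4) by (intro image_eqI[of _ _ 0]) (auto simp: q_def)
    fix z s assume "z \<in> q ` {..<?M}" and s: "s \<in> {i, j}"
    then obtain n where n: "n < ?M" "z = q n" by auto
    have "s = a n \<or> s = a (Suc n)" using s by (auto simp: a_def alt_letter_def)
    then show "step X z s \<in> q ` {..<?M}"
    proof
      assume s: "s = a n"
      show ?thesis
      proof (cases "Suc n < ?M")
        case True
        then show ?thesis using up[of n] n s by auto
      next
        case False
        then have "n = ?M - 1" using n by simp
        then show ?thesis
          using step_loop[of "a n" x X "q n"] chain(2) a_I assms(4) n s by auto
      qed
    next
      assume s: "s = a (Suc n)"
      show ?thesis
      proof (cases n)
        case 0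
        then show ?thesis
          using step_loop[of "a (Suc n)" x X "q 0"] loop0[of "Suc n"] a_I assms(4) n s by auto
      next
        case (Suc n')
        then show ?thesis using down[of n'] n s by (auto simp: a_SS)
      qed
    qed
  qed
  then obtain n where n: "n < ?M" "w = q n" by auto
  \<comment> \<open>Which of the two words starts with the letter leading forward depends on the parity of \<open>n\<close>;
    both are covered by the computation.\<close>
  have "{W n ?M, W (Suc n) ?M} = {alt_word i j ?M, alt_word j i ?M}"
    by (auto simp: W_def a_def alt_letter_def)
  then show "state X w (alt_word i j ?M) = state X w (alt_word j i ?M)"
    "cocycle X w (alt_word i j ?M) = cocycle X w (alt_word j i ?M)"
    using main[OF n(1)] n(2) by (metis (no_types) doubleton_eq_iff)+
qed

lemma act_alt_word:
  assumes "{i, j} \<in> E"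
  shows "act (map fst (alt_word i j (m {i, j}))) = act (map fst (alt_word j i (m {i, j})))"
  using act_braid[OF assms] by (auto simp: alt_word_eq_alt_end)

lemma artin_eq_braid:
  assumes "{i, j} \<in> E"
  shows "alt_word i j (m {i, j}) \<simeq> alt_word j i (m {i, j})"
  using artin_eq_alt_end[OF assms] by (auto simp: alt_word_eq_alt_end intro: pres_rel.sym)

text \<open>
The state is joined by steps in \<open>i\<close> and \<open>j\<close> to some \<open>v\<close> that is minimal on the right. If \<open>v\<close> sends
neither simple root to one of \<open>X\<close>, nothing is ever emitted; if it sends both to such roots, then
\<open>v\<close> is the only state and the emitted words are the two sides of a braid relation of \<open>A\<^sub>X\<close> with the
same label, by invariance of the form; otherwise the states form the chain treated above.
\<close>

lemma braid_invariance:
  assumes "{i, j} \<in> E" "X \<subseteq> I" "w \<in> coset_reps X"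
  shows "state X w (alt_word i j (m {i, j})) = state X w (alt_word j i (m {i, j}))"
    "cocycle X w (alt_word i j (m {i, j})) \<simeq> cocycle X w (alt_word j i (m {i, j}))"
proof -
  note e = edgeD[OF assms(1)]
  let ?M = "m {i, j}"
  have Y: "{i, j} \<subseteq> I" using e by simp
  obtain u where u: "u \<in> lists {i, j}"
      "\<forall>y\<in>{i, j}. nonneg (state X w (positive u) (\<alpha> y))"
      "state X (state X w (positive u)) (positive (rev u)) = w"
    using state_descend[OF assms(2) Y assms(3)] by blast
  define v where "v = state X w (positive u)"
  have v: "v \<in> coset_reps X" "nonneg (v (\<alpha> i))" "nonneg (v (\<alpha> j))"
    "state X v (positive (rev u)) = w"
    using u state_in_coset_reps[OF assms(3)] by (auto simp: v_def)
  have ru: "rev u \<in> lists {i, j}" using u(1) by auto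
  have refl: "cocycle X w z \<simeq> cocycle X w z" if "z \<in> words I" for z
    using that cocycle_in_words[OF assms(2,3) that] assms(2)
    by (intro pres_rel.refl) (auto intro: words_mono)
  have alt: "alt_word i j ?M \<in> words I" "alt_word j i ?M \<in> words I"
    using e by (auto intro: alt_word_in_words)
  have swap: "{j, i} \<in> E" "m {j, i} = ?M" using assms(1) by (simp_all add: insert_commute)
  consider (none) "\<And>x y. x \<in> X \<Longrightarrow> y \<in> {i, j} \<Longrightarrow> v (\<alpha> y) \<noteq> \<alpha> x"
    | (both) x y where "x \<in> X" "y \<in> X" "v (\<alpha> i) = \<alpha> x" "v (\<alpha> j) = \<alpha> y"
    | (i) x where "x \<in> X" "v (\<alpha> i) = \<alpha> x" "\<forall>y\<in>X. v (\<alpha> j) \<noteq> \<alpha> y"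
    | (j) x where "x \<in> X" "v (\<alpha> j) = \<alpha> x" "\<forall>y\<in>X. v (\<alpha> i) \<noteq> \<alpha> y"
    by blast
  then have "state X w (alt_word i j ?M) = state X w (alt_word j i ?M)
    \<and> cocycle X w (alt_word i j ?M) \<simeq> cocycle X w (alt_word j i ?M)"
  proof cases
    case none
    have gen: "state X (v \<circ> act g) z = v \<circ> act (g @ map fst z) \<and> cocycle X (v \<circ> act g) z = []"
      if "v \<circ> act g \<in> coset_reps X" "g \<in> lists {i, j}" "z \<in> words {i, j}" for g z
      using moves_without_matched_root[OF assms(2) Y v(1) _ none that] v(2,3) by blast
    have "v \<circ> act [] \<in> coset_reps X" using v(1) by simp
    from gen[OF this, of "positive (rev u)"] ru v(4)
    have w: "w = v \<circ> act (rev u)" by (simp add: positive_in_words)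
    have "alt_word i j ?M \<in> words {i, j}" "alt_word j i ?M \<in> words {i, j}"
      by (auto intro: alt_word_in_words)
    then show ?thesis
      using gen[of "rev u"] assms(3) ru act_alt_word[OF assms(1)]
      by (simp add: w[symmetric] act_append pres_rel.refl)
  next
    case both
    have "x \<noteq> y" using both e(3) cox_eqD[OF coset_reps_cox[OF v(1)]] simple_root_eq_iff by metis
    moreover have "cartan x y = cartan i j"
      using bil_cox[OF coset_reps_cox[OF v(1)], of "\<alpha> i" "\<alpha> j"] both e assms(2)
      by (auto simp: bil_simple_roots subset_iff)
    ultimately have xy: "{x, y} \<in> E" "m {x, y} = ?M"
      using cartan_determines_edge[OF assms(1)] by auto
    have "state X v (positive (rev u)) \<in> {v}"
    proof (rule state_invariant_set[OF _ _ ru])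
      show "step X z s \<in> {v}" if "z \<in> {v}" "s \<in> {i, j}" for z s
        using that step_loop[of i x X v] step_loop[of j y X v] both e by auto
    qed simp
    then have "w = v" using v(4) by simp
    then show ?thesis
      using cocycle_both_loops[OF e(1,2) both(1,2,3,4)] cocycle_both_loops[OF e(2,1) both(2,1,4,3)]
        artin_eq_braid[OF xy(1)] xy(2) by simp
  next
    case i
    show ?thesis
      using braid_one_loop[OF assms(1,2) v(1) i(1,2) v(3) i(3) ru] v(4) refl[OF alt(1)] by simp
  next
    case j
    have ru': "rev u \<in> lists {j, i}" using ru by (simp add: insert_commute)
    show ?thesis
      using braid_one_loop[OF swap(1) assms(2) v(1) j(1,2) v(2) j(3) ru'] v(4) refl[OF alt(1)] swap(2)
      by simp
  qed
  then show "state X w (alt_word i j ?M) = state X w (alt_word j i ?M)"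
    "cocycle X w (alt_word i j ?M) \<simeq> cocycle X w (alt_word j i ?M)" by auto
qed

lemma state_cong:
  assumes "(u, v) \<in> pres_rel I (coxeter_relations I E m)" "X \<subseteq> I"
  shows "w \<in> coset_reps X \<Longrightarrow> state X w u = state X w v"
  using assms(1)
proof (induction arbitrary: w rule: pres_rel.induct)
  case (cancel a p q e)
  then show ?case
    using step_cancel(1)[OF state_in_coset_reps[OF cancel(4)] assms(2), of a] by (simp add: state_append)
next
  case (relator u v p q)
  define z where "z = state X w p"
  have z: "z \<in> coset_reps X" using relator by (simp add: z_def state_in_coset_reps)
  have "state X z u = state X z v"
    using relator(1) unfolding coxeter_relations_def
  proof
    assume "(u, v) \<in> {([(i, True), (i, True)], []) | i. i \<in> I}"
    then show ?thesis using step_cancel(1)[OF z assms(2)] by auto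
  next
    assume "(u, v) \<in> braid_relations E m"
    then show ?thesis using braid_invariance(1)[OF _ assms(2) z] by (auto simp: braid_relations_def)
  qed
  then show ?case by (simp add: state_append z_def)
qed auto

lemma artin_eq_coxeter: "u \<simeq> v \<Longrightarrow> (u, v) \<in> pres_rel I (coxeter_relations I E m)"
  using pres_rel_mono[of "braid_relations E m" "coxeter_relations I E m" I]
  by (auto simp: coxeter_relations_def)

lemma cocycle_cong:
  assumes "u \<simeq> v" "X \<subseteq> I"
  shows "w \<in> coset_reps X \<Longrightarrow> cocycle X w u \<simeq> cocycle X w v"
  using assms(1)
proof (induction arbitrary: w rule: pres_rel.induct)
  case (refl u)
  then show ?case
    using cocycle_in_words[OF assms(2)] assms(2)
    by (intro pres_rel.refl) (auto intro: words_mono)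
next
  case (sym u v)
  then show ?case by (blast intro: pres_rel.sym)
next
  case (trans u v w)
  then show ?case by (blast intro: pres_rel.trans)
next
  case (cancel a p q e)
  define z where "z = state X w p"
  have z: "z \<in> coset_reps X" using cancel by (simp add: z_def state_in_coset_reps)
  have words: "cocycle X w p \<in> words I" "cocycle X z q \<in> words I"
    using cocycle_in_words[OF assms(2)] cancel z assms(2) by (auto intro: words_mono)
  have "state X z [(a, e), (a, \<not> e)] = z" using step_cancel(1)[OF z assms(2) cancel(1)] by simp
  then show ?case
    using pres_rel_context[OF step_cancel(2)[OF z assms(2) cancel(1), of e] words]
    by (simp only: cocycle_append z_def[symmetric] append_Nil)
next
  case (relator u v p q)
  define z where "z = state X w p"
  have z: "z \<in> coset_reps X" using relator by (simp add: z_def state_in_coset_reps)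
  obtain i j where ij: "{i, j} \<in> E" "u = alt_word i j (m {i, j})" "v = alt_word j i (m {i, j})"
    using relator(1) by (auto simp: braid_relations_def)
  have words: "cocycle X w p \<in> words I" "cocycle X (state X z u) q \<in> words I"
    using cocycle_in_words[OF assms(2)] relator z assms(2)
    by (auto intro: words_mono state_in_coset_reps)
  show ?case
    using pres_rel_context[OF braid_invariance(2)[OF ij(1) assms(2) z] words]
      braid_invariance(1)[OF ij(1) assms(2) z]
    by (simp add: cocycle_append z_def[symmetric] ij(2,3))
qed

end

context artin_graph
begin

section \<open>Faithfulness of the reflection representation\<close>

abbreviation coxeter_eq :: "'v word \<Rightarrow> 'v word \<Rightarrow> bool" (infix "\<approx>" 50) where
  "u \<approx> v \<equiv> (u, v) \<in> pres_rel I (coxeter_relations I E m)"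

lemma coxeter_eq_context: "u \<approx> v \<Longrightarrow> p \<in> words I \<Longrightarrow> q \<in> words I \<Longrightarrow> p @ u @ q \<approx> p @ v @ q"
  by (rule pres_rel_context)

lemma coxeter_eq_square:
  assumes "s \<in> I" shows "[(s, True), (s, True)] \<approx> []"
proof -
  have "([(s, True), (s, True)], []) \<in> coxeter_relations I E m"
    using assms by (auto simp: coxeter_relations_def)
  then show ?thesis
    using pres_rel.relator[of _ _ _ I "[]" "[]"] assms by fastforce
qed

lemma coxeter_eq_letter:
  assumes "s \<in> I" shows "[(s, e)] \<approx> [(s, True)]"
proof (cases e)
  case True
  then show ?thesis using assms by (auto intro: pres_rel.refl)
next
  case False
  have "[(s, False)] @ [(s, True), (s, True)] \<approx> [(s, False)] @ []"
    using coxeter_eq_context[OF coxeter_eq_square[OF assms], of "[(s, False)]" "[]"] assms by simp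
  moreover have "[(s, False), (s, True)] @ [(s, True)] \<approx> [(s, True)]"
    using pres_rel.cancel[of s I "[]" "[(s, True)]" False] assms by simp
  ultimately show ?thesis using False by (auto intro: pres_rel.sym pres_rel.trans)
qed

lemma coxeter_eq_positive: "u \<in> words I \<Longrightarrow> u \<approx> positive (map fst u)"
proof (induction u)
  case (Cons l u)
  obtain s e where l: "l = (s, e)" by force
  have "[(s, e)] @ u \<approx> [(s, True)] @ positive (map fst u)"
    using Cons l by (intro pres_rel_append coxeter_eq_letter) auto
  then show ?case by (simp add: l)
qed (auto intro: pres_rel.refl)

text \<open>
If the next letter is a descent, the reduced word may be rewritten by Matsumoto's theorem
so that it ends in this letter, which then cancels.
\<close>

lemma coxeter_eq_reduced:
  "u \<in> lists I \<Longrightarrow> \<exists>r. reduced r \<and> act r = act u \<and> positive u \<approx> positive r"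
proof (induction u rule: rev_induct)
  case Nil
  then show ?case by (intro exI[of _ "[]"]) (auto simp: reduced_def intro: pres_rel.refl)
next
  case (snoc s u)
  have s: "s \<in> I" "u \<in> lists I" using snoc.prems by auto
  then obtain r where r: "reduced r" "act r = act u" "positive u \<approx> positive r"
    using snoc.IH by blast
  have r_lists: "r \<in> lists I" "act r \<in> cox_group" using r(1) by (auto simp: reduced_def)
  have s_words: "[(s, True)] \<in> words I" using s by simp
  have us: "positive (u @ [s]) \<approx> positive r @ [(s, True)]"
    using coxeter_eq_context[OF r(3), of "[]" "[(s, True)]"] s by simp
  show ?case
  proof (cases "nonneg (act r (\<alpha> s))")
    case True
    then show ?thesis
      using reduced_snoc[OF r(1) s(1)] r(2) us by (intro exI[of _ "r @ [s]"]) (simp add: act_snoc)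
  next
    case False
    have "act r \<circ> reflection s \<in> cox_group" using r_lists s by simp
    then obtain r' where r': "reduced r'" "act r' = act r \<circ> reflection s"
      by (rule reduced_witness)
    have act_eq: "act (r' @ [s]) = act r" using r'(2) s by (simp add: act_snoc)
    have "reduced (r' @ [s])"
      using len_descent[OF r_lists(2) s(1) False] r' act_eq s by (auto simp: reduced_def)
    then have "positive r \<simeq> positive (r' @ [s])" by (rule matsumoto[OF r(1) _ act_eq[symmetric]])
    then have "positive r \<approx> positive r' @ [(s, True)]"
      using artin_eq_coxeter by fastforce
    then have "positive r @ [(s, True)] \<approx> positive r' @ [(s, True), (s, True)]"
      using coxeter_eq_context[of "positive r" "positive r' @ [(s, True)]" "[]" "[(s, True)]"] s
      by simp
    moreover have "positive r' @ [(s, True), (s, True)] \<approx> positive r'"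
      using coxeter_eq_context[OF coxeter_eq_square[OF s(1)], of "positive r'" "[]"] r'(1)
      by (simp add: reduced_def positive_in_words)
    ultimately have "positive (u @ [s]) \<approx> positive r'" using us by (blast intro: pres_rel.trans)
    moreover have "act r' = act (u @ [s])" using r'(2) r(2) by (simp add: act_snoc)
    ultimately show ?thesis using r'(1) by blast
  qed
qed

theorem reflection_representation_faithful:
  assumes "u \<in> words I" "v \<in> words I" "act (map fst u) = act (map fst v)"
  shows "u \<approx> v"
proof -
  obtain r where r: "reduced r" "act r = act (map fst u)" "positive (map fst u) \<approx> positive r"
    using coxeter_eq_reduced[OF map_fst_in_lists[OF assms(1)]] by blast
  obtain r' where r': "reduced r'" "act r' = act (map fst v)" "positive (map fst v) \<approx> positive r'"
    using coxeter_eq_reduced[OF map_fst_in_lists[OF assms(2)]] by blast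
  have "positive r \<approx> positive r'"
    using matsumoto[OF r(1) r'(1)] r(2) r'(2) assms(3) by (intro artin_eq_coxeter) simp
  then show ?thesis
    using coxeter_eq_positive[OF assms(1)] coxeter_eq_positive[OF assms(2)] r(3) r'(3)
    by (meson pres_rel.sym pres_rel.trans)
qed

lemma colored_if_acts_trivially:
  assumes "u \<in> words I" "act (map fst u) = id"
  shows "pres_rel I (braid_relations E m) `` {u} \<in> colored_artin_group I E m"
proof -
  have "u \<approx> []" by (rule reflection_representation_faithful) (use assms in auto)
  then have "pres_rel I (coxeter_relations I E m) `` {u} = pres_rel I (coxeter_relations I E m) `` {[]}"
    by (rule equiv_class_eq[OF equiv_pres_rel])
  then show ?thesis
    using assms(1) by (simp add: colored_artin_group_def kernel_def artin_group_def
      coxeter_group_def carrier_presented_group quotientI one_presented_group artin_to_coxeter_class)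
qed

lemma cocycle_on_parabolic:
  assumes "X \<subseteq> I"
  shows "u \<in> words X \<Longrightarrow> state X id u = id \<and> cocycle X id u = u"
proof (induction u)
  case (Cons l u)
  obtain s e where l: "l = (s, e)" by force
  have "s \<in> X" using Cons.prems l by simp
  moreover from this have "s \<in> I" using assms by blast
  ultimately have "step X id s = id" "emitted X id (s, e) = [(s, e)]"
    using step_loop[of s s X id, OF _ _ id_apply] by blast+
  then show ?case using Cons by (simp add: l del: id_apply)
qed simp

text \<open>
The letters emitted at fixed steps record the \<open>W\<^sub>X\<close>-part: together with the state they recover the
element of \<open>W\<close>.
\<close>

lemma act_cocycle_state:
  assumes "X \<subseteq> I"
  shows "w \<in> coset_reps X \<Longrightarrow> u \<in> words I \<Longrightarrow>
    act (map fst (cocycle X w u)) \<circ> state X w u = w \<circ> act (map fst u)"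
proof (induction u arbitrary: w)
  case (Cons l u)
  obtain s e where l: "l = (s, e)" by force
  have s: "s \<in> I" using Cons.prems l by simp
  have u: "u \<in> words I" using Cons.prems by simp
  show ?case using Cons.prems(1) assms s
  proof (rule step_cases)
    assume "w \<circ> reflection s \<in> coset_reps X" "step X w s = w \<circ> reflection s"
      "\<And>e. emitted X w (s, e) = []"
    then show ?thesis using Cons.IH[OF _ u] by (simp add: l comp_assoc)
  next
    fix x assume x: "x \<in> X" "w (\<alpha> s) = \<alpha> x" "step X w s = w" "\<And>e. emitted X w (s, e) = [(x, e)]"
    have "w \<circ> reflection s = reflection x \<circ> w"
      using cox_reflection_conj[OF coset_reps_cox[OF Cons.prems(1)] s _ x(2)] x(1) assms by auto
    then have "w \<circ> (reflection s \<circ> act (map fst u)) = reflection x \<circ> (w \<circ> act (map fst u))"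
      by (simp add: comp_assoc[symmetric])
    then show ?thesis using Cons.IH[OF Cons.prems(1) u] x by (simp add: l comp_assoc del: comp_apply)
  qed
qed simp

text \<open>
Every prefix of a reduced expression of a minimal representative is again one, so all its steps
move.
\<close>

lemma state_reduced:
  assumes "X \<subseteq> I"
  shows "reduced r \<Longrightarrow> act r \<in> coset_reps X \<Longrightarrow> state X id (positive r) = act r"
proof (induction r rule: rev_induct)
  case (snoc s r)
  have r: "reduced r" using snoc.prems(1) by (rule reduced_prefix)
  have s: "s \<in> I" "r \<in> lists I" using snoc.prems by (auto simp: reduced_def)
  have eq: "act (r @ [s]) \<circ> reflection s = act r" using s by (simp add: act_snoc)
  have "len (act (r @ [s]) \<circ> reflection s) < len (act (r @ [s]))"
    using snoc.prems(1) r unfolding eq by (simp add: reduced_def)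
  then have "\<not> nonneg (act (r @ [s]) (\<alpha> s))"
    using len_ascent[of "act (r @ [s])" s] s by auto
  then have "act r \<in> coset_reps X"
    using coset_reps_descent[OF snoc.prems(2) assms s(1)] eq by simp
  then have "state X id (positive r) = act r" using snoc.IH r by blast
  moreover have "step X (act r) s = act (r @ [s])"
    using snoc.prems(2) by (simp add: step_def act_snoc del: comp_apply)
  ultimately show ?case by (simp add: state_append del: id_apply)
qed simp

lemma state_eq_act:
  assumes "X \<subseteq> I" "u \<in> words I" "act (map fst u) \<in> coset_reps X"
  shows "state X id u = act (map fst u)"
proof -
  obtain r where r: "reduced r" "act r = act (map fst u)"
    using reduced_witness[OF coset_reps_cox[OF assms(3)]] by blast
  have "positive r \<in> words I" using r(1) by (simp add: reduced_def positive_in_words)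
  then have "u \<approx> positive r"
    using assms(2) r(2) by (intro reflection_representation_faithful) auto
  then have "state X id u = state X id (positive r)" by (rule state_cong[OF _ assms(1)]) simp
  then show ?thesis using state_reduced[OF assms(1) r(1)] r(2) assms(3) by simp
qed

section \<open>Emission along a second parabolic subgroup\<close>

text \<open>
For \<open>d\<close> minimal in \<open>W\<^sub>X d W\<^sub>Y\<close> this is the subset \<open>Z\<close> of \<open>X\<close> with \<open>W\<^sub>X \<inter> d W\<^sub>Y d\<inverse> = W\<^sub>Z\<close>.
\<close>

definition matched_roots :: "(('v \<Rightarrow> real) \<Rightarrow> 'v \<Rightarrow> real) \<Rightarrow> 'v set \<Rightarrow> 'v set \<Rightarrow> 'v set" where
  "matched_roots d X Y = {x \<in> X. \<exists>y\<in>Y. d (\<alpha> y) = \<alpha> x}"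

lemma cocycle_from_double_rep:
  assumes "X \<subseteq> I" "Y \<subseteq> I" "d \<in> cox_group" "\<And>y. y \<in> Y \<Longrightarrow> nonneg (d (\<alpha> y))"
  shows "d \<circ> act g \<in> coset_reps X \<Longrightarrow> g \<in> lists Y \<Longrightarrow> u \<in> words Y \<Longrightarrow>
    cocycle X (d \<circ> act g) u \<in> words (matched_roots d X Y)"
proof (induction u arbitrary: g)
  case (Cons l u)
  obtain s e where l: "l = (s, e)" by force
  have s: "s \<in> Y" "u \<in> words Y" using Cons.prems l by auto
  have sI: "s \<in> I" using s assms(2) by auto
  show ?case using Cons.prems(1) assms(1) sI
  proof (rule step_cases)
    assume *: "d \<circ> act g \<circ> reflection s \<in> coset_reps X"
      "step X (d \<circ> act g) s = d \<circ> act g \<circ> reflection s" "\<And>e. emitted X (d \<circ> act g) (s, e) = []"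
    have eq: "d \<circ> act g \<circ> reflection s = d \<circ> act (g @ [s])" by (simp add: act_append comp_assoc)
    have "g @ [s] \<in> lists Y" using Cons.prems s by simp
    then show ?thesis
      using Cons.IH[of "g @ [s]"] *(1) s(2) unfolding l cocycle.simps fst_conv *(2,3) eq
      by (simp del: comp_apply)
  next
    fix x assume x: "x \<in> X" "(d \<circ> act g) (\<alpha> s) = \<alpha> x" "step X (d \<circ> act g) s = d \<circ> act g"
      "\<And>e. emitted X (d \<circ> act g) (s, e) = [(x, e)]"
    have "x \<in> matched_roots d X Y"
      using simple_root_from_parabolic[OF assms(3,2) _ assms(4) Cons.prems(2) s(1) x(2)] x(1) assms(1)
      by (auto simp: matched_roots_def)
    then show ?thesis
      using Cons.IH[OF Cons.prems(1,2) s(2)] unfolding l cocycle.simps fst_conv x(3,4)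
      by (simp del: comp_apply)
  qed
qed simp

text \<open>
Both sides of \<open>a u = u b\<close> emit equal elements from the state \<open>1\<close>. The word \<open>a\<close> over \<open>X\<close> fixes this
state and emits itself, and \<open>b\<close> is read from the state reached by \<open>u\<close>.
\<close>

lemma conjugator_absorbs_into_cocycle:
  assumes "X \<subseteq> I" "Y \<subseteq> I" "u \<in> words I" "\<And>y. y \<in> Y \<Longrightarrow> nonneg (state X id u (\<alpha> y))"
    and "a \<in> words X" "b \<in> words Y" "a @ u \<simeq> u @ b"
  shows "\<exists>c\<in>words (matched_roots (state X id u) X Y). a @ cocycle X id u \<simeq> cocycle X id u @ c"
proof
  let ?d = "state X id u"
  have d: "?d \<in> coset_reps X" by (rule state_in_coset_reps) simp
  show "cocycle X ?d b \<in> words (matched_roots ?d X Y)"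
    using cocycle_from_double_rep[OF assms(1,2) coset_reps_cox[OF d] assms(4), of "[]" b] d assms(6)
    by (simp del: comp_apply id_apply)
  show "a @ cocycle X id u \<simeq> cocycle X id u @ cocycle X ?d b"
    using cocycle_cong[OF assms(7,1), of id] cocycle_on_parabolic[OF assms(1,5)]
    by (simp add: cocycle_append)
qed

text \<open>
Both sides spell reduced expressions of the same element: \<open>w s = t w\<close> is longer than \<open>w\<close>, as the
root \<open>w \<alpha>\<^sub>s = \<alpha>\<^sub>t\<close> is nonnegative.
\<close>

lemma simple_reflection_conjugates_lift:
  assumes "reduced r" "s \<in> I" "t \<in> I" "act r (\<alpha> s) = \<alpha> t"
  shows "positive r @ [(s, True)] \<simeq> (t, True) # positive r"
proof -
  have r: "act r \<in> cox_group" "r \<in> lists I" using assms(1) by (auto simp: reduced_def)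
  have "reduced (r @ [s])" using reduced_snoc[OF assms(1,2)] assms(4) by simp
  moreover have eq: "act (r @ [s]) = act (t # r)"
    using cox_reflection_conj[OF r(1) assms(2-4)] by (simp add: act_snoc)
  ultimately have "reduced (t # r)" using r assms(3) by (auto simp: reduced_def)
  then show ?thesis using matsumoto[OF \<open>reduced (r @ [s])\<close> _ eq] by simp
qed

end

section \<open>Conjugates and intersections of parabolic subgroups\<close>

context group
begin

lemma conj_subgroup_in_carrier:
  "g \<in> carrier G \<Longrightarrow> H \<subseteq> carrier G \<Longrightarrow> conj_subgroup G g H \<subseteq> carrier G"
  by (auto simp: conj_subgroup_def)

lemma conj_subgroup_mult:
  assumes "g \<in> carrier G" "h \<in> carrier G" "H \<subseteq> carrier G"
  shows "conj_subgroup G (g \<otimes> h) H = conj_subgroup G g (conj_subgroup G h H)"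
  unfolding conj_subgroup_def image_image
  by (rule image_cong) (use assms in \<open>auto simp: inv_mult_group m_assoc\<close>)

lemma conj_subgroup_one: "H \<subseteq> carrier G \<Longrightarrow> conj_subgroup G \<one> H = H"
  by (force simp: conj_subgroup_def)

lemma conj_subgroup_Int:
  assumes "g \<in> carrier G" "H \<subseteq> carrier G" "K \<subseteq> carrier G"
  shows "conj_subgroup G g (H \<inter> K) = conj_subgroup G g H \<inter> conj_subgroup G g K"
proof -
  have "inj_on (\<lambda>h. g \<otimes> h \<otimes> inv g) (carrier G)"
    using assms(1) by (auto simp: inj_on_def)
  then show ?thesis unfolding conj_subgroup_def by (rule inj_on_image_Int) (use assms in auto)
qed

lemma conj_subgroup_inv_cancel:
  assumes "g \<in> carrier G" "H \<subseteq> carrier G"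
  shows "conj_subgroup G g (conj_subgroup G (inv g) H) = H"
  using assms by (simp add: conj_subgroup_mult[symmetric] conj_subgroup_one)

lemma conj_subgroup_self:
  assumes "subgroup H G" "h \<in> H" shows "conj_subgroup G h H = H"
proof -
  have sub: "conj_subgroup G k H \<subseteq> H" if "k \<in> H" for k
    using that assms(1) by (auto simp: conj_subgroup_def subgroup.m_closed subgroup.m_inv_closed)
  have h: "h \<in> carrier G" "H \<subseteq> carrier G" using assms subgroup.subset by auto
  have "H = conj_subgroup G h (conj_subgroup G (inv h) H)"
    using h by (simp add: conj_subgroup_inv_cancel)
  also have "\<dots> \<subseteq> conj_subgroup G h H"
    unfolding conj_subgroup_def[of G h]
    by (intro image_mono sub subgroup.m_inv_closed assms)
  finally show ?thesis using sub[OF assms(2)] by blast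
qed

lemma conj_subgroup_generate:
  assumes "g \<in> carrier G" "S \<subseteq> carrier G"
  shows "conj_subgroup G g (generate G S) = generate G (conj_subgroup G g S)"
proof -
  interpret conj: group_hom G G "\<lambda>h. g \<otimes> h \<otimes> inv g"
  proof
    show "(\<lambda>h. g \<otimes> h \<otimes> inv g) \<in> hom G G"
      using assms(1) by (intro homI) (simp_all add: m_assoc inv_solve_left)
  qed
  show ?thesis unfolding conj_subgroup_def using conj.generate_img[OF assms(2)] by simp
qed

end

definition inv_word :: "'a word \<Rightarrow> 'a word" where
  "inv_word u = rev (map (\<lambda>(a, e). (a, \<not> e)) u)"

lemma inv_word_in_words: "u \<in> words S \<Longrightarrow> inv_word u \<in> words S"
  by (induction u) (auto simp: inv_word_def)

lemma map_fst_inv_word: "map fst (inv_word u) = rev (map fst u)"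
  by (induction u) (auto simp: inv_word_def)

context artin_graph
begin

abbreviation artin :: "'v word set monoid" where "artin \<equiv> artin_group I E m"

abbreviation parab :: "'v set \<Rightarrow> 'v word set set" where "parab X \<equiv> standard_parabolic I E m X"

abbreviation cls :: "'v word \<Rightarrow> 'v word set" where
  "cls u \<equiv> pres_rel I (braid_relations E m) `` {u}"

sublocale artin: group artin
  unfolding artin_group_def by (rule group_presented_group)

lemma cls_in_carrier [simp]: "u \<in> words I \<Longrightarrow> cls u \<in> carrier artin"
  by (simp add: artin_group_def carrier_presented_group quotientI)

lemma carrier_artinE:
  assumes "x \<in> carrier artin" obtains u where "u \<in> words I" "x = cls u"
  using assms unfolding artin_group_def carrier_presented_group by (rule quotientE)

lemma cls_mult: "u \<in> words I \<Longrightarrow> v \<in> words I \<Longrightarrow> cls u \<otimes>\<^bsub>artin\<^esub> cls v = cls (u @ v)"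
  by (simp add: artin_group_def mult_presented_group)

lemma cls_one: "\<one>\<^bsub>artin\<^esub> = cls []"
  by (simp add: artin_group_def one_presented_group)

lemma cls_eq_iff: "u \<in> words I \<Longrightarrow> v \<in> words I \<Longrightarrow> cls u = cls v \<longleftrightarrow> u \<simeq> v"
  by (rule eq_equiv_class_iff[OF equiv_pres_rel])

lemma cls_inv:
  assumes "u \<in> words I" shows "inv\<^bsub>artin\<^esub> cls u = cls (inv_word u)"
proof (rule artin.inv_equality)
  have "cls (inv_word u @ u) = cls []"
    unfolding inv_word_def by (rule equiv_class_eq[OF equiv_pres_rel pres_rel_inverse[OF assms]])
  then show "cls (inv_word u) \<otimes>\<^bsub>artin\<^esub> cls u = \<one>\<^bsub>artin\<^esub>"
    using assms by (simp add: cls_mult inv_word_in_words cls_one)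
qed (use assms in \<open>simp_all add: inv_word_in_words\<close>)

lemma artin_gen_cls: "artin_gen I E m i = cls [(i, True)]"
  by (simp add: artin_gen_def pres_gen_def)

lemma artin_gen_in_carrier: "X \<subseteq> I \<Longrightarrow> artin_gen I E m ` X \<subseteq> carrier artin"
  by (auto simp: artin_gen_cls)

lemma subgroup_parab: "X \<subseteq> I \<Longrightarrow> subgroup (parab X) artin"
  unfolding standard_parabolic_def by (intro artin.generate_is_subgroup artin_gen_in_carrier)

lemma parab_in_carrier: "X \<subseteq> I \<Longrightarrow> parab X \<subseteq> carrier artin"
  using subgroup_parab subgroup.subset by blast

lemma parab_mono: "X \<subseteq> Y \<Longrightarrow> parab X \<subseteq> parab Y"
  unfolding standard_parabolic_def by (intro artin.mono_generate image_mono)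

lemma parab_eq_cls_words:
  assumes "X \<subseteq> I" shows "parab X = cls ` words X"
proof
  have wI: "u \<in> words I" if "u \<in> words X" for u using that assms by (rule words_mono)
  have "x \<in> cls ` words X" if "x \<in> generate artin (artin_gen I E m ` X)" for x
    using that
  proof (induction rule: generate.induct)
    case one
    then show ?case by (auto simp: cls_one)
  next
    case (incl h)
    then show ?case by (auto simp: artin_gen_cls)
  next
    case (inv h)
    then obtain i where "i \<in> X" "h = cls [(i, True)]" by (auto simp: artin_gen_cls)
    then show ?case
      using assms by (auto simp: cls_inv inv_word_def intro!: imageI)
  next
    case (eng h k)
    then obtain u v where "u \<in> words X" "h = cls u" "v \<in> words X" "k = cls v" by auto
    then show ?case using wI by (auto simp: cls_mult intro!: imageI)
  qed
  then show "parab X \<subseteq> cls ` words X" by (auto simp: standard_parabolic_def)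
  have "cls u \<in> parab X" if "u \<in> words X" for u
    using that
  proof (induction u)
    case Nil
    then show ?case using subgroup.one_closed[OF subgroup_parab[OF assms]] by (simp add: cls_one)
  next
    case (Cons l u)
    obtain i e where l: "l = (i, e)" by force
    have i: "i \<in> X" "i \<in> I" "u \<in> words X" using Cons.prems l assms by auto
    have gen: "cls [(i, True)] \<in> parab X"
      using i unfolding standard_parabolic_def artin_gen_cls[symmetric] by (intro generate.incl) auto
    have "cls [(i, e)] \<in> parab X"
    proof (cases e)
      case False
      have "inv\<^bsub>artin\<^esub> cls [(i, True)] = cls [(i, False)]"
        using i by (simp add: cls_inv inv_word_def)
      then show ?thesis using subgroup.m_inv_closed[OF subgroup_parab[OF assms] gen] False by simp
    qed (use gen in simp)
    then have "cls [(i, e)] \<otimes>\<^bsub>artin\<^esub> cls u \<in> parab X"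
      using Cons.IH i(3) by (intro subgroup.m_closed[OF subgroup_parab[OF assms]])
    then show ?case using i wI by (simp add: cls_mult l)
  qed
  then show "cls ` words X \<subseteq> parab X" by auto
qed

lemma parabolic_conj:
  assumes "g \<in> carrier artin" "parabolic_subgroup I E m P"
  shows "parabolic_subgroup I E m (conj_subgroup artin g P)"
proof -
  obtain h X where "h \<in> carrier artin" "X \<subseteq> I" "P = conj_subgroup artin h (parab X)"
    using assms(2) by (auto simp: parabolic_subgroup_def)
  then show ?thesis
    using assms(1) unfolding parabolic_subgroup_def
    by (intro bexI[of _ "g \<otimes>\<^bsub>artin\<^esub> h"] exI[of _ X])
       (auto simp: artin.conj_subgroup_mult parab_in_carrier)
qed

text \<open>
With \<open>p\<close> the element of \<open>A\<^sub>X\<close> emitted along \<open>u\<close>, the intersection lies in \<open>p A\<^sub>Z p\<inverse>\<close>, which in turn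
lies in \<open>A\<^sub>X\<close>; so \<open>A\<^sub>X\<close> may be replaced by \<open>p A\<^sub>Z p\<inverse>\<close>, and conjugation by \<open>p\<close> brings this to \<open>A\<^sub>Z\<close>.
\<close>

lemma intersection_in_matched_parabolic:
  assumes "X \<subseteq> I" "Y \<subseteq> I" "u \<in> words I"
  defines "d \<equiv> state X id u"
  assumes "\<And>y. y \<in> Y \<Longrightarrow> nonneg (d (\<alpha> y))"
  obtains p v where "p \<in> carrier artin" "v \<in> words I" "act (map fst v) = d"
    "conj_subgroup artin (cls u) (parab Y) \<inter> parab X =
      conj_subgroup artin p (conj_subgroup artin (cls v) (parab Y) \<inter> parab (matched_roots d X Y))"
proof -
  define c where "c = cocycle X id u"
  define Z where "Z = matched_roots d X Y"
  define v where "v = inv_word c @ u"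
  have Z: "Z \<subseteq> X" "Z \<subseteq> I" using assms(1) by (auto simp: Z_def matched_roots_def)
  have cX: "c \<in> words X" unfolding c_def by (rule cocycle_in_words[OF assms(1) _ assms(3)]) simp
  have c: "c \<in> words I" using words_mono[OF cX assms(1)] .
  have v: "v \<in> words I" using c assms(3) by (simp add: v_def inv_word_in_words)
  have uv: "cls u = cls c \<otimes>\<^bsub>artin\<^esub> cls v"
  proof -
    have "cls v = inv\<^bsub>artin\<^esub> cls c \<otimes>\<^bsub>artin\<^esub> cls u"
      using c assms(3) by (simp add: v_def cls_inv cls_mult inv_word_in_words)
    then show ?thesis using c assms(3) by (simp add: artin.m_assoc[symmetric])
  qed
  have act_v: "act (map fst v) = d"
  proof -
    have "act (map fst c) \<circ> d = act (map fst u)"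
      using act_cocycle_state[OF assms(1) _ assms(3), of id] by (simp add: c_def d_def del: id_apply)
    then have "act (map fst v) = act (rev (map fst c)) \<circ> (act (map fst c) \<circ> d)"
      by (simp add: v_def act_append map_fst_inv_word)
    then show ?thesis using act_rev(2)[OF map_fst_in_lists[OF c]] by (auto simp: fun_eq_iff)
  qed
  let ?P = "conj_subgroup artin (cls u) (parab Y) \<inter> parab X"
  have "?P \<subseteq> conj_subgroup artin (cls c) (parab Z)"
  proof
    fix x assume x: "x \<in> ?P"
    then obtain a where a: "a \<in> words X" "x = cls a" using parab_eq_cls_words[OF assms(1)] by auto
    from x obtain b where b: "b \<in> words Y" "x = cls u \<otimes>\<^bsub>artin\<^esub> cls b \<otimes>\<^bsub>artin\<^esub> inv\<^bsub>artin\<^esub> cls u"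
      using parab_eq_cls_words[OF assms(2)] by (auto simp: conj_subgroup_def)
    have ab: "a \<in> words I" "b \<in> words I" using a b assms(1,2) by (auto intro: words_mono)
    have "cls (a @ u) = cls (u @ b)"
      using b(2) ab assms(3) by (simp add: cls_mult[symmetric] a(2)[symmetric] artin.m_assoc)
    then have "a @ u \<simeq> u @ b" using ab assms(3) by (simp add: cls_eq_iff)
    then obtain z where z: "z \<in> words Z" "a @ c \<simeq> c @ z"
      using conjugator_absorbs_into_cocycle[OF assms(1-3) _ a(1) b(1)] assms(5)
      by (auto simp: d_def Z_def c_def)
    have zI: "z \<in> words I" using z(1) Z(2) by (rule words_mono)
    have "cls (a @ c) = cls (c @ z)" using z(2) ab c zI by (simp add: cls_eq_iff)
    then have "x \<otimes>\<^bsub>artin\<^esub> cls c = cls c \<otimes>\<^bsub>artin\<^esub> cls z"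
      using ab c zI a(2) by (simp add: cls_mult)
    then have "x = cls c \<otimes>\<^bsub>artin\<^esub> cls z \<otimes>\<^bsub>artin\<^esub> inv\<^bsub>artin\<^esub> cls c"
      using ab c zI a(2) by (simp add: artin.inv_solve_right)
    then show "x \<in> conj_subgroup artin (cls c) (parab Z)"
      using z(1) parab_eq_cls_words[OF Z(2)] by (auto simp: conj_subgroup_def)
  qed
  moreover have "conj_subgroup artin (cls c) (parab Z) \<subseteq> parab X"
  proof -
    have "conj_subgroup artin (cls c) (parab Z) \<subseteq> conj_subgroup artin (cls c) (parab X)"
      using parab_mono[OF Z(1)] unfolding conj_subgroup_def by (rule image_mono)
    also have "\<dots> = parab X"
      by (rule artin.conj_subgroup_self[OF subgroup_parab[OF assms(1)]])
         (use cX parab_eq_cls_words[OF assms(1)] in auto)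
    finally show ?thesis .
  qed
  ultimately have P: "?P = conj_subgroup artin (cls u) (parab Y) \<inter> conj_subgroup artin (cls c) (parab Z)"
    by blast
  have "conj_subgroup artin (cls u) (parab Y) =
      conj_subgroup artin (cls c) (conj_subgroup artin (cls v) (parab Y))"
    unfolding uv using c v assms(2) by (simp add: artin.conj_subgroup_mult parab_in_carrier)
  moreover have "conj_subgroup artin (cls c) (conj_subgroup artin (cls v) (parab Y) \<inter> parab Z) =
      conj_subgroup artin (cls c) (conj_subgroup artin (cls v) (parab Y))
      \<inter> conj_subgroup artin (cls c) (parab Z)"
    using c v assms(2) Z(2)
    by (intro artin.conj_subgroup_Int artin.conj_subgroup_in_carrier parab_in_carrier) auto
  ultimately have "?P = conj_subgroup artin (cls c) (conj_subgroup artin (cls v) (parab Y) \<inter> parab Z)"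
    using P by (simp only:)
  then show thesis using that[OF cls_in_carrier[OF c] v act_v] by (simp add: Z_def)
qed

lemma conj_lift_parab:
  assumes "reduced r" "Z \<subseteq> I" "Y \<subseteq> I"
    and "\<And>z. z \<in> Z \<Longrightarrow> \<exists>y\<in>Y. act r (\<alpha> z) = \<alpha> y" "\<And>y. y \<in> Y \<Longrightarrow> \<exists>z\<in>Z. act r (\<alpha> z) = \<alpha> y"
  shows "conj_subgroup artin (cls (positive r)) (parab Z) = parab Y"
proof -
  have r: "positive r \<in> words I" using assms(1) by (simp add: reduced_def positive_in_words)
  have conj_gen: "cls (positive r) \<otimes>\<^bsub>artin\<^esub> artin_gen I E m z \<otimes>\<^bsub>artin\<^esub> inv\<^bsub>artin\<^esub> cls (positive r)
      = artin_gen I E m y"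
    if "z \<in> I" "y \<in> I" "act r (\<alpha> z) = \<alpha> y" for z y
  proof -
    have "cls (positive r @ [(z, True)]) = cls ((y, True) # positive r)"
      using simple_reflection_conjugates_lift[OF assms(1) that] r that by (simp add: cls_eq_iff)
    then have "cls (positive r) \<otimes>\<^bsub>artin\<^esub> cls [(z, True)] = cls [(y, True)] \<otimes>\<^bsub>artin\<^esub> cls (positive r)"
      using r that by (simp add: cls_mult)
    then show ?thesis
      using r that by (simp add: artin_gen_cls artin.m_assoc)
  qed
  have "conj_subgroup artin (cls (positive r)) (artin_gen I E m ` Z) = artin_gen I E m ` Y"
    unfolding conj_subgroup_def
  proof (intro equalityI subsetI)
    fix x assume "x \<in> (\<lambda>h. cls (positive r) \<otimes>\<^bsub>artin\<^esub> h \<otimes>\<^bsub>artin\<^esub> inv\<^bsub>artin\<^esub> cls (positive r)) `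
      artin_gen I E m ` Z"
    then show "x \<in> artin_gen I E m ` Y"
      using assms(2-4) conj_gen by blast
  next
    fix x assume "x \<in> artin_gen I E m ` Y"
    then obtain y z where yz: "y \<in> Y" "x = artin_gen I E m y" "z \<in> Z" "act r (\<alpha> z) = \<alpha> y"
      using assms(5) by blast
    then have "x = cls (positive r) \<otimes>\<^bsub>artin\<^esub> artin_gen I E m z \<otimes>\<^bsub>artin\<^esub> inv\<^bsub>artin\<^esub> cls (positive r)"
      using conj_gen[of z y] assms(2,3) by auto
    then show "x \<in> (\<lambda>h. cls (positive r) \<otimes>\<^bsub>artin\<^esub> h \<otimes>\<^bsub>artin\<^esub> inv\<^bsub>artin\<^esub> cls (positive r)) `
      artin_gen I E m ` Z"
      using yz(3) by (intro image_eqI[of _ _ "artin_gen I E m z"]) auto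
  qed
  then show ?thesis
    unfolding standard_parabolic_def
    using artin.conj_subgroup_generate[OF cls_in_carrier[OF r] artin_gen_in_carrier[OF assms(2)]]
    by simp
qed

text \<open>
Shrinking \<open>X\<close> to \<open>Z\<close> and then, for the inverse element, \<open>Y\<close> to \<open>Y'\<close> leaves two sets of generators
that the underlying element of the Coxeter group matches bijectively. Its positive lift conjugates
one standard parabolic subgroup to the other, and what remains is a colored element.
\<close>

theorem parabolic_intersection_if_colored:
  assumes colored: "\<And>X c. X \<subseteq> I \<Longrightarrow> c \<in> colored_artin_group I E m \<Longrightarrow>
      parabolic_subgroup I E m (conj_subgroup artin c (parab X) \<inter> parab X)"
    and X: "X \<subseteq> I" and Y: "Y \<subseteq> I" and g: "g \<in> carrier artin"
  shows "parabolic_subgroup I E m (conj_subgroup artin g (parab Y) \<inter> parab X)"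
proof -
  obtain u0 where u0: "u0 \<in> words I" "g = cls u0" using g by (rule carrier_artinE)
  have "state X id u0 \<in> coset_reps X" by (rule state_in_coset_reps) simp
  then obtain h where h: "h \<in> lists Y"
    "\<forall>y\<in>Y. nonneg (state X (state X id u0) (positive h) (\<alpha> y))"
    using state_descend[OF X Y] by blast
  define u where "u = u0 @ positive h"
  have hY: "positive h \<in> words Y" using h(1) by (simp add: positive_in_words)
  have hI: "positive h \<in> words I" using hY Y by (rule words_mono)
  have u: "u \<in> words I" using u0 hI by (simp add: u_def)
  define d where "d = state X id u"
  have d_pos: "nonneg (d (\<alpha> y))" if "y \<in> Y" for y
    using h(2) that by (simp add: d_def u_def state_append del: id_apply)
  have gu: "conj_subgroup artin g (parab Y) = conj_subgroup artin (cls u) (parab Y)"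
  proof -
    have "cls u = g \<otimes>\<^bsub>artin\<^esub> cls (positive h)" using u0 hI by (simp add: u_def cls_mult)
    moreover have "conj_subgroup artin (cls (positive h)) (parab Y) = parab Y"
      by (rule artin.conj_subgroup_self[OF subgroup_parab[OF Y]])
         (use hY parab_eq_cls_words[OF Y] in auto)
    ultimately show ?thesis
      using g hI parab_in_carrier[OF Y] by (simp add: artin.conj_subgroup_mult)
  qed
  define Z where "Z = matched_roots d X Y"
  have Z: "Z \<subseteq> I" using X by (auto simp: Z_def matched_roots_def)
  obtain p v where p: "p \<in> carrier artin" and v: "v \<in> words I" "act (map fst v) = d"
    and P: "conj_subgroup artin (cls u) (parab Y) \<inter> parab X =
      conj_subgroup artin p (conj_subgroup artin (cls v) (parab Y) \<inter> parab Z)"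
    using intersection_in_matched_parabolic[OF X Y u d_pos[unfolded d_def]] unfolding d_def Z_def by blast
  define v' where "v' = inv_word v"
  have v': "v' \<in> words I" using v(1) by (simp add: v'_def inv_word_in_words)
  have vv': "cls v' = inv\<^bsub>artin\<^esub> cls v" using v(1) by (simp add: v'_def cls_inv)
  define d' where "d' = act (map fst v')"
  have dd': "d (d' f) = f" "d' (d f) = f" for f
    using act_rev[OF map_fst_in_lists[OF v(1)]] v(2)
    by (simp_all add: d'_def v'_def map_fst_inv_word)
  have d'_root: "d' (\<alpha> x) = \<alpha> y \<longleftrightarrow> d (\<alpha> y) = \<alpha> x" for x y
    using dd' by metis
  have "d' \<in> cox_group" using v' by (simp add: d'_def map_fst_in_lists)
  then have d'_rep: "d' \<in> coset_reps Y"
    using d_pos dd'(1) by (auto simp: coset_reps_def) (metis)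
  have d'_state: "state Y id v' = d'"
    using state_eq_act[OF Y v'] d'_rep by (simp add: d'_def)
  have d'_pos: "nonneg (d' (\<alpha> z))" if "z \<in> Z" for z
    using that d'_root by (auto simp: Z_def matched_roots_def) (metis nonneg_simple_root)
  define Y' where "Y' = matched_roots d' Y Z"
  have Y': "Y' \<subseteq> I" using Y by (auto simp: Y'_def matched_roots_def)
  obtain q w where q: "q \<in> carrier artin" and w: "w \<in> words I" "act (map fst w) = d'"
    and Q: "conj_subgroup artin (cls v') (parab Z) \<inter> parab Y =
      conj_subgroup artin q (conj_subgroup artin (cls w) (parab Z) \<inter> parab Y')"
    using intersection_in_matched_parabolic[OF Y Z v' d'_pos[folded d'_state]] unfolding d'_state Y'_def by blast
  obtain r where r: "reduced r" "act r = d'" using \<open>d' \<in> cox_group\<close> by (rule reduced_witness)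
  have rI: "positive r \<in> words I" "r \<in> lists I" using r(1) by (auto simp: reduced_def positive_in_words)
  \<comment> \<open>Both \<open>r\<close> and \<open>w\<close> lie over \<open>d'\<close>, so the quotient is colored.\<close>
  define k where "k = inv_word (positive r) @ w"
  have k: "k \<in> words I" using rI w by (simp add: k_def inv_word_in_words)
  have wk: "cls w = cls (positive r) \<otimes>\<^bsub>artin\<^esub> cls k"
  proof -
    have "cls k = inv\<^bsub>artin\<^esub> cls (positive r) \<otimes>\<^bsub>artin\<^esub> cls w"
      using rI w(1) by (simp add: k_def cls_inv cls_mult inv_word_in_words)
    then show ?thesis using rI w(1) by (simp add: artin.m_assoc[symmetric])
  qed
  have "act (map fst k) = act (rev r) \<circ> act r"
    using w(2) r(2) by (simp add: k_def act_append map_fst_inv_word)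
  then have "act (map fst k) = id" using act_rev(2)[OF rI(2)] by auto
  then have "cls k \<in> colored_artin_group I E m" by (rule colored_if_acts_trivially[OF k])
  then have par: "parabolic_subgroup I E m (conj_subgroup artin (cls k) (parab Z) \<inter> parab Z)"
    by (rule colored[OF Z])
  have lift: "conj_subgroup artin (cls (positive r)) (parab Z) = parab Y'"
  proof (rule conj_lift_parab[OF r(1) Z Y'])
    show "\<exists>y\<in>Y'. act r (\<alpha> z) = \<alpha> y" if zZ: "z \<in> Z" for z
    proof -
      obtain y where "y \<in> Y" "d (\<alpha> y) = \<alpha> z" using zZ by (auto simp: Z_def matched_roots_def)
      then show ?thesis using zZ d'_root r(2) by (auto simp: Y'_def matched_roots_def)
    qed
    show "\<exists>z\<in>Z. act r (\<alpha> z) = \<alpha> y" if "y \<in> Y'" for y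
      using that r(2) by (auto simp: Y'_def matched_roots_def)
  qed
  have "conj_subgroup artin (cls w) (parab Z) \<inter> parab Y' =
      conj_subgroup artin (cls (positive r)) (conj_subgroup artin (cls k) (parab Z) \<inter> parab Z)"
    using rI k Z
    by (simp add: wk artin.conj_subgroup_mult artin.conj_subgroup_Int lift
        artin.conj_subgroup_in_carrier parab_in_carrier)
  then have parQ: "parabolic_subgroup I E m (conj_subgroup artin (cls v') (parab Z) \<inter> parab Y)"
    unfolding Q using par q rI by (simp add: parabolic_conj)
  have "conj_subgroup artin (cls v) (conj_subgroup artin (cls v') (parab Z) \<inter> parab Y) =
      conj_subgroup artin (cls v) (parab Y) \<inter> parab Z"
    using v(1) Y Z
    by (simp add: vv' artin.conj_subgroup_Int artin.conj_subgroup_in_carrier parab_in_carrier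
        artin.conj_subgroup_inv_cancel Int_commute)
  then have "parabolic_subgroup I E m (conj_subgroup artin (cls v) (parab Y) \<inter> parab Z)"
    using parabolic_conj[OF cls_in_carrier[OF v(1)] parQ] by simp
  then show ?thesis unfolding gu P by (rule parabolic_conj[OF p])
qed

end

section \<open>Renaming the vertices\<close>

definition rename_word :: "('a \<Rightarrow> 'b) \<Rightarrow> 'a word \<Rightarrow> 'b word" where
  "rename_word f u = map (map_prod f id) u"

lemma rename_word_simps [simp]:
  "rename_word f [] = []"
  "rename_word f ((a, e) # u) = (f a, e) # rename_word f u"
  "rename_word f (u @ v) = rename_word f u @ rename_word f v"
  by (auto simp: rename_word_def)

lemma rename_word_in_words: "u \<in> words S \<Longrightarrow> rename_word f u \<in> words (f ` S)"
  by (induction u) (auto simp: rename_word_def)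

lemma rename_word_inverse:
  assumes "\<And>a. a \<in> S \<Longrightarrow> g (f a) = a"
  shows "u \<in> words S \<Longrightarrow> rename_word g (rename_word f u) = u"
  by (induction u) (auto simp: assms rename_word_def)

lemma rename_alt_word: "rename_word f (alt_word i j n) = alt_word (f i) (f j) n"
  by (induction n arbitrary: i j) auto

abbreviation rename_relations :: "('a \<Rightarrow> 'b) \<Rightarrow> ('a word \<times> 'a word) set \<Rightarrow> ('b word \<times> 'b word) set" where
  "rename_relations f R \<equiv> map_prod (rename_word f) (rename_word f) ` R"

lemma pres_rel_rename:
  "(u, v) \<in> pres_rel S R \<Longrightarrow>
    (rename_word f u, rename_word f v) \<in> pres_rel (f ` S) (rename_relations f R)"
proof (induction rule: pres_rel.induct)
  case (refl w)
  then show ?case by (intro pres_rel.refl rename_word_in_words)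
next
  case (sym u v)
  then show ?case by (blast intro: pres_rel.sym)
next
  case (trans u v w)
  then show ?case by (blast intro: pres_rel.trans)
next
  case (cancel a p q e)
  then show ?case
    using pres_rel.cancel[of "f a" "f ` S" "rename_word f p" "rename_word f q" e]
    by (auto simp: rename_word_in_words)
next
  case (relator u v p q)
  then show ?case
    using pres_rel.relator[of "rename_word f u" "rename_word f v" "rename_relations f R" "f ` S"
        "rename_word f p" "rename_word f q"]
    by (auto simp: rename_word_in_words)
qed

text \<open>
Renaming by \<open>f\<close> preserves the congruence, and renaming back by an inverse shows that every word
congruent to a renamed word is itself renamed from the original class.
\<close>

lemma rename_class:
  assumes f: "inj_on f S" and R: "R \<subseteq> words S \<times> words S" and u: "u \<in> words S"
  shows "rename_word f ` (pres_rel S R `` {u}) =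
    pres_rel (f ` S) (rename_relations f R) `` {rename_word f u}"
proof
  show "rename_word f ` (pres_rel S R `` {u})
    \<subseteq> pres_rel (f ` S) (rename_relations f R) `` {rename_word f u}"
    using pres_rel_rename by fast
  define g where "g = inv_into S f"
  have g: "g (f a) = a" if "a \<in> S" for a using that f by (simp add: g_def)
  have fg: "f (g b) = b" if "b \<in> f ` S" for b using that by (simp add: g_def f_inv_into_f)
  have gS: "g ` f ` S = S" using g by force
  have gR: "rename_relations g (rename_relations f R) = R"
  proof -
    have "rename_relations g (rename_relations f R) = (\<lambda>x. x) ` R"
      unfolding image_image
      by (rule image_cong) (use R rename_word_inverse[of S g f] g in \<open>auto simp: subset_iff\<close>)
    then show ?thesis by simp
  qed
  show "pres_rel (f ` S) (rename_relations f R) `` {rename_word f u}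
    \<subseteq> rename_word f ` (pres_rel S R `` {u})"
  proof
    fix v assume "v \<in> pres_rel (f ` S) (rename_relations f R) `` {rename_word f u}"
    then have v: "(rename_word f u, v) \<in> pres_rel (f ` S) (rename_relations f R)" by simp
    then have "(u, rename_word g v) \<in> pres_rel S R"
      using pres_rel_rename[OF v, of g] rename_word_inverse[of S g f u] g u gS gR by simp
    moreover have "v = rename_word f (rename_word g v)"
      using rename_word_inverse[of "f ` S" f g v] fg pres_rel_words[OF v] by simp
    ultimately show "v \<in> rename_word f ` (pres_rel S R `` {u})" by blast
  qed
qed

text \<open>
The image of a graph under an injective map of its vertices, and the isomorphism of Artin groups
that it induces. On classes of words it is the image under renaming.
\<close>

locale renamed_artin_graph = artin_graph I E m
  for I :: "'v set" and E :: "'v set set" and m :: "'v set \<Rightarrow> nat" +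
  fixes f :: "'v \<Rightarrow> 'w"
  assumes inj: "inj_on f I"
begin

definition I' :: "'w set" where "I' = f ` I"
definition E' :: "'w set set" where "E' = (`) f ` E"
definition m' :: "'w set \<Rightarrow> nat" where "m' e = m (inv_into I f ` e)"

lemma edge_subset: "e \<in> E \<Longrightarrow> e \<subseteq> I"
  using labelled_graph by (auto simp: labelled_graph_def)

lemma m'_image: "e \<in> E \<Longrightarrow> m' (f ` e) = m e"
  using inv_into_image_cancel[OF inj edge_subset] by (simp add: m'_def)

lemma labelled_graph': "labelled_graph I' E' m'"
proof -
  have "card (f ` e) = 2" if "e \<in> E" for e
    using that labelled_graph card_image[OF inj_on_subset[OF inj edge_subset[OF that]]]
    by (simp add: labelled_graph_def)
  then show ?thesis
    using labelled_graph edge_subset m'_image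
    by (auto simp: labelled_graph_def I'_def E'_def)
qed

sublocale renamed: artin_graph I' E' m'
  by unfold_locales (rule labelled_graph')

lemma braid_relations_renamed: "braid_relations E' m' = rename_relations f (braid_relations E m)"
proof (intro equalityI subsetI)
  fix r assume "r \<in> braid_relations E' m'"
  then obtain a b where r: "r = (alt_word a b (m' {a, b}), alt_word b a (m' {a, b}))" "{a, b} \<in> E'"
    by (auto simp: braid_relations_def)
  then obtain e where e: "e \<in> E" "{a, b} = f ` e" by (auto simp: E'_def)
  then have "card e = 2" using labelled_graph by (simp add: labelled_graph_def)
  then obtain i j where "e = {i, j}" by (auto simp: card_2_iff)
  moreover from this have "{a, b} = {f i, f j}" using e by simp
  ultimately obtain i j where ij: "e = {i, j}" "a = f i" "b = f j"
    by (metis doubleton_eq_iff)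
  have "m' {a, b} = m {i, j}"
    by (rule HOL.trans[OF arg_cong[OF e(2)]]) (use m'_image[OF e(1)] ij(1) in simp)
  then show "r \<in> rename_relations f (braid_relations E m)"
    using e ij r
    by (intro image_eqI[of _ _ "(alt_word i j (m {i, j}), alt_word j i (m {i, j}))"])
       (auto simp: rename_alt_word braid_relations_def)
next
  fix r assume "r \<in> rename_relations f (braid_relations E m)"
  then obtain i j where ij: "{i, j} \<in> E"
      "r = (alt_word (f i) (f j) (m {i, j}), alt_word (f j) (f i) (m {i, j}))"
    by (auto simp: braid_relations_def rename_alt_word)
  moreover have "{f i, f j} \<in> E'" using imageI[OF ij(1), of "(`) f"] by (simp add: E'_def)
  moreover have "m' {f i, f j} = m {i, j}" using m'_image[OF ij(1)] by simp
  ultimately show "r \<in> braid_relations E' m'"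
    unfolding braid_relations_def by (intro CollectI exI[of _ "f i"] exI[of _ "f j"]) simp
qed

lemma coxeter_relations_renamed:
  "coxeter_relations I' E' m' = rename_relations f (coxeter_relations I E m)"
proof -
  have squares: "{([(i, True), (i, True)], []) | i. i \<in> J} = (\<lambda>i. ([(i, True), (i, True)], [])) ` J"
    for J :: "'x set" by auto
  show ?thesis
    unfolding coxeter_relations_def image_Un braid_relations_renamed squares I'_def image_image
    by simp
qed

lemma relations_in_words:
  "braid_relations E m \<subseteq> words I \<times> words I" "coxeter_relations I E m \<subseteq> words I \<times> words I"
  using edgeD by (auto simp: braid_relations_def coxeter_relations_def intro!: alt_word_in_words)

abbreviation rn :: "'v word set \<Rightarrow> 'w word set" where "rn \<equiv> (`) (rename_word f)"

lemma rename_in_words: "u \<in> words I \<Longrightarrow> rename_word f u \<in> words I'"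
  by (simp add: I'_def rename_word_in_words)

lemma rn_cls: "u \<in> words I \<Longrightarrow> rn (cls u) = renamed.cls (rename_word f u)"
  using rename_class[OF inj relations_in_words(1)] by (simp add: I'_def braid_relations_renamed)

lemma rn_coxeter_class:
  "u \<in> words I \<Longrightarrow> rn (pres_rel I (coxeter_relations I E m) `` {u}) =
    pres_rel I' (coxeter_relations I' E' m') `` {rename_word f u}"
  unfolding coxeter_relations_renamed
  using rename_class[OF inj relations_in_words(2)] by (simp only: I'_def)

lemma inj_on_rn: "inj_on rn (carrier artin)"
proof -
  have "inj_on (rename_word f) (words I)"
    using rename_word_inverse[of I "inv_into I f" f] inj
    by (intro inj_on_inverseI[of _ "rename_word (inv_into I f)"]) auto
  then have "inj_on rn (Pow (words I))" by (rule inj_on_image_Pow)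
  moreover have "carrier artin \<subseteq> Pow (words I)"
    using pres_rel_words by (auto elim!: carrier_artinE)
  ultimately show ?thesis by (rule inj_on_subset)
qed

sublocale rn: group_hom artin renamed.artin rn
proof
  show "rn \<in> hom artin renamed.artin"
  proof (rule homI)
    show "rn x \<in> carrier renamed.artin" if "x \<in> carrier artin" for x
      using that by (rule carrier_artinE) (simp add: rn_cls rename_in_words)
    show "rn (x \<otimes>\<^bsub>artin\<^esub> y) = rn x \<otimes>\<^bsub>renamed.artin\<^esub> rn y"
      if x: "x \<in> carrier artin" and y: "y \<in> carrier artin" for x y
    proof -
      obtain u where "u \<in> words I" "x = cls u" using x by (rule carrier_artinE)
      moreover obtain v where "v \<in> words I" "y = cls v" using y by (rule carrier_artinE)
      ultimately show ?thesis
        by (simp add: cls_mult renamed.cls_mult rn_cls rename_in_words)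
    qed
  qed
qed

lemma rn_surj:
  assumes "y \<in> carrier renamed.artin" obtains x where "x \<in> carrier artin" "y = rn x"
proof -
  obtain v where v: "v \<in> words I'" "y = renamed.cls v" using assms by (rule renamed.carrier_artinE)
  define u where "u = rename_word (inv_into I f) v"
  have "inv_into I f ` I' = I" using inj by (auto simp: I'_def inv_into_image_cancel)
  then have u: "u \<in> words I"
    using rename_word_in_words[OF v(1), of "inv_into I f"] by (simp add: u_def)
  have "rename_word f u = v"
    unfolding u_def by (rule rename_word_inverse[OF _ v(1)]) (simp add: I'_def f_inv_into_f)
  then show thesis using that[of "cls u"] u v(2) by (simp add: rn_cls)
qed

lemma rn_artin_gen:
  assumes "i \<in> I" shows "rn (artin_gen I E m i) = artin_gen I' E' m' (f i)"
proof -
  have "[(i, True)] \<in> words I" using assms by simp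
  from rn_cls[OF this] show ?thesis
    unfolding artin_gen_cls renamed.artin_gen_cls rename_word_simps .
qed

lemma rn_parab:
  assumes "X \<subseteq> I" shows "rn ` parab X = renamed.parab (f ` X)"
proof -
  have "rn ` artin_gen I E m ` X = artin_gen I' E' m' ` f ` X"
    unfolding image_image
    by (rule image_cong[OF HOL.refl]) (rule rn_artin_gen[OF subsetD[OF assms]])
  then show ?thesis
    unfolding standard_parabolic_def
    using rn.generate_img[OF artin_gen_in_carrier[OF assms]] by simp
qed

lemma rn_conj:
  assumes "g \<in> carrier artin" "H \<subseteq> carrier artin"
  shows "rn ` conj_subgroup artin g H = conj_subgroup renamed.artin (rn g) (rn ` H)"
  unfolding conj_subgroup_def image_image[of rn] image_image[of _ rn]
  by (rule image_cong) (use assms in \<open>auto simp: subset_iff simp del: image_image\<close>)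

lemma rn_colored:
  assumes "c \<in> colored_artin_group I E m" shows "rn c \<in> colored_artin_group I' E' m'"
proof -
  have c: "c \<in> carrier artin" "artin_to_coxeter I E m c = \<one>\<^bsub>coxeter_group I E m\<^esub>"
    using assms by (auto simp: colored_artin_group_def kernel_def)
  obtain u where u: "u \<in> words I" "c = cls u" using c(1) by (rule carrier_artinE)
  have "pres_rel I (coxeter_relations I E m) `` {u} = pres_rel I (coxeter_relations I E m) `` {[]}"
    using c(2) u by (simp add: artin_to_coxeter_class coxeter_group_def one_presented_group)
  then have "pres_rel I' (coxeter_relations I' E' m') `` {rename_word f u} =
      pres_rel I' (coxeter_relations I' E' m') `` {[]}"
    using rn_coxeter_class[OF u(1)] rn_coxeter_class[of "[]"] by simp
  then show ?thesis
    using u rename_in_words[OF u(1)]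
    by (simp add: colored_artin_group_def kernel_def rn_cls artin_to_coxeter_class
        coxeter_group_def one_presented_group)
qed

lemma parabolic_of_renamed:
  assumes "P \<subseteq> carrier artin" "parabolic_subgroup I' E' m' (rn ` P)"
  shows "parabolic_subgroup I E m P"
proof -
  obtain g' X' where g': "g' \<in> carrier renamed.artin" "X' \<subseteq> I'"
    "rn ` P = conj_subgroup renamed.artin g' (renamed.parab X')"
    using assms(2) by (auto simp: parabolic_subgroup_def)
  obtain g where g: "g \<in> carrier artin" "g' = rn g" using g'(1) by (rule rn_surj)
  obtain X where X: "X \<subseteq> I" "X' = f ` X" using g'(2) by (auto simp: I'_def subset_image_iff)
  have "rn ` P = rn ` conj_subgroup artin g (parab X)"
    using g' g X by (simp only: rn_conj[OF g(1) parab_in_carrier[OF X(1)]] rn_parab)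
  then have "P = conj_subgroup artin g (parab X)"
    using inj_on_image_eq_iff[OF inj_on_rn assms(1)]
      artin.conj_subgroup_in_carrier[OF g(1) parab_in_carrier[OF X(1)]] by simp
  then show ?thesis using g(1) X(1) by (auto simp: parabolic_subgroup_def)
qed

lemma colored_intersection_of_renamed:
  assumes "\<And>X c. X \<subseteq> I' \<Longrightarrow> c \<in> colored_artin_group I' E' m' \<Longrightarrow>
      parabolic_subgroup I' E' m' (conj_subgroup renamed.artin c (renamed.parab X) \<inter> renamed.parab X)"
    and X: "X \<subseteq> I" and c: "c \<in> colored_artin_group I E m"
  shows "parabolic_subgroup I E m (conj_subgroup artin c (parab X) \<inter> parab X)"
proof (rule parabolic_of_renamed)
  have cG: "c \<in> carrier artin" using c by (simp add: colored_artin_group_def kernel_def)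
  note carr = parab_in_carrier[OF X] artin.conj_subgroup_in_carrier[OF cG parab_in_carrier[OF X]]
  show "conj_subgroup artin c (parab X) \<inter> parab X \<subseteq> carrier artin" using carr by blast
  have "rn ` (conj_subgroup artin c (parab X) \<inter> parab X) =
      rn ` conj_subgroup artin c (parab X) \<inter> rn ` parab X"
    by (rule inj_on_image_Int[OF inj_on_rn carr(2,1)])
  also have "\<dots> = conj_subgroup renamed.artin (rn c) (renamed.parab (f ` X)) \<inter> renamed.parab (f ` X)"
    by (simp only: rn_conj[OF cG carr(1)] rn_parab[OF X])
  finally show "parabolic_subgroup I' E' m' (rn ` (conj_subgroup artin c (parab X) \<inter> parab X))"
    using assms(1)[of "f ` X" "rn c"] X rn_colored[OF c] by (auto simp: I'_def)
qed

end

section \<open>Reduction to the colored case\<close>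

theorem theorem0p5:
  assumes "\<forall>(I :: nat set) E m X \<omega>.
      labelled_graph I E m \<and> X \<subseteq> I \<and> \<omega> \<in> colored_artin_group I E m \<longrightarrow>
      parabolic_subgroup I E m
        (conj_subgroup (artin_group I E m) \<omega> (standard_parabolic I E m X)
          \<inter> standard_parabolic I E m X)"
  shows "\<forall>(I :: 'v set) E m X Y \<omega>.
      labelled_graph I E m \<and> X \<subseteq> I \<and> Y \<subseteq> I \<and> \<omega> \<in> carrier (artin_group I E m) \<longrightarrow>
      parabolic_subgroup I E m
        (conj_subgroup (artin_group I E m) \<omega> (standard_parabolic I E m Y)
          \<inter> standard_parabolic I E m X)"
proof (intro allI impI)
  fix I :: "'v set" and E m X Y \<omega>
  assume *: "labelled_graph I E m \<and> X \<subseteq> I \<and> Y \<subseteq> I \<and> \<omega> \<in> carrier (artin_group I E m)"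
  then interpret artin_graph I E m by unfold_locales simp
  obtain f :: "'v \<Rightarrow> nat" where "inj_on f I"
    using finite_imp_inj_to_nat_seg[OF finite_I] by blast
  then interpret renamed_artin_graph I E m f by unfold_locales
  show "parabolic_subgroup I E m
      (conj_subgroup (artin_group I E m) \<omega> (standard_parabolic I E m Y) \<inter> standard_parabolic I E m X)"
  proof (rule parabolic_intersection_if_colored)
    show "parabolic_subgroup I E m (conj_subgroup artin c (parab Z) \<inter> parab Z)"
      if "Z \<subseteq> I" "c \<in> colored_artin_group I E m" for Z c
      using assms labelled_graph' that by (intro colored_intersection_of_renamed) auto
  qed (use * in auto)
qed

end
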